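(* Let $G$ be a discrete group, let $\omega$ be a weight on $G$, let $1\le p<\infty$, and let $q\in(1,\infty]$ be the index conjugate to $p$, i.e. $1/p+1/q=1$. Suppose that there exist a bounded function $u:G\to\mathbb{R}^+$, a real number $s<q$, and $r>0$ such that $\sigma=\omega u$ is bounded away from zero, $$\frac{\omega(xy)}{\omega(x)\omega(y)}\le u(x)+u(y)\quad (x,y\in G),\qquad\text{and}\qquad \sum_{x\in G}u(x)^s\omega(x)^r<\infty.$$ Then $\ell^p(G,\omega)$ is a Banach $*$-algebra with respect to the convolution product, it is inverse-closed in $C^*_r(G)$, and $\ell^p(G,\omega)$ admits norm-controlled inversion in $C^*_r(G)$. In particular, this conclusion holds if $\omega$ is weakly subadditive and $\omega^{-1}\in\ell^s(G)$ for some $0<s<q$.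
   Context: A weight on a discrete group $G$ is a function $\omega:G\to[0,\infty)$ with $\omega(e)=1$, $\omega(x)=\omega(x^{-1})$ and $\omega(xy)\le\omega(x)\omega(y)$ for all $x,y\in G$. It is weakly subadditive if there is $D>0$ with $\omega(xy)\le D(\omega(x)+\omega(y))$ for all $x,y\in G$. $\mathbb{R}^+=[0,\infty)$. $\ell^p(G,\omega)=\{f:G\to\mathbb{C} : f\omega\in\ell^p(G)\}$ with norm $\|f\|_{p,\omega}=\|f\omega\|_p$; the involution is $f^*(x)=\overline{f(x^{-1})}$ and the unit is $\delta_e$. For these spaces, "Banach algebra under convolution" means that the space is closed under convolution and $\|f*g\|_{p,\omega}\le K\|f\|_{p,\omega}\|g\|_{p,\omega}$ for some constant $K>0$ (so an equivalent norm is submultiplicative). $C^*_r(G)$ is the reduced $C^*$-algebra of $G$, the norm closure in $B(\ell^2(G))$ of the operators $g\mapsto f*g$, $f\in\ell^1(G)$; elements of $\ell^p(G,\omega)$ (which under the hypotheses lie in $\ell^1(G)$) are regarded as elements of $C^*_r(G)$ in this way. For algebras $\mathcal{A}\subseteq\mathcal{B}$ with a common unit: $\mathcal{A}$ is inverse-closed in $\mathcal{B}$ if every $a\in\mathcal{A}$ that is invertible in $\mathcal{B}$ satisfies $a^{-1}\in\mathcal{A}$. In this case $\mathcal{A}$ admits norm-controlled inversion in $\mathcal{B}$ if there is a function $h:\mathbb{R}^+\times\mathbb{R}^+\to\mathbb{R}^+$ such that $\|a^{-1}\|_{\mathcal{A}}\le h(\|a\|_{\mathcal{A}},\|a^{-1}\|_{\mathcal{B}})$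 for every $a\in\mathcal{A}$ invertible in $\mathcal{B}$. *)

theory Defs
  imports "HOL-Analysis.Analysis"
begin

text \<open>
  A discrete group is a type of class \<^class>\<open>group_add\<close>. This class does not assume commutativity:
  \<open>x + y\<close> is the group product \<open>xy\<close>, \<open>- x\<close> is \<open>x\<inverse>\<close> and \<open>0\<close> is the identity \<open>e\<close>.
\<close>

section \<open>Weights\<close>

definition weight :: "('a::group_add \<Rightarrow> real) \<Rightarrow> bool" where
  "weight \<omega> \<longleftrightarrow> (\<forall>x. 0 \<le> \<omega> x) \<and> \<omega> 0 = 1 \<and> (\<forall>x. \<omega> (- x) = \<omega> x) \<and>
     (\<forall>x y. \<omega> (x + y) \<le> \<omega> x * \<omega> y)"

definition weakly_subadditive :: "('a::group_add \<Rightarrow> real) \<Rightarrow> bool" where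
  "weakly_subadditive \<omega> \<longleftrightarrow> (\<exists>D>0. \<forall>x y. \<omega> (x + y) \<le> D * (\<omega> x + \<omega> y))"

definition bounded_away_from_zero :: "('a \<Rightarrow> real) \<Rightarrow> bool" where
  "bounded_away_from_zero \<sigma> \<longleftrightarrow> (\<exists>c>0. \<forall>x. c \<le> \<sigma> x)"


section \<open>The spaces \<open>\<ell>\<^sup>p(G)\<close> and \<open>\<ell>\<^sup>p(G, \<omega>)\<close>\<close>

definition lp :: "real \<Rightarrow> ('a \<Rightarrow> 'b::real_normed_vector) set" where
  "lp p = {f. (\<lambda>x. norm (f x) powr p) summable_on UNIV}"

definition lp_norm :: "real \<Rightarrow> ('a \<Rightarrow> 'b::real_normed_vector) \<Rightarrow> real" where
  "lp_norm p f = (\<Sum>\<^sub>\<infinity>x. norm (f x) powr p) powr (1 / p)"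

definition lpw :: "real \<Rightarrow> ('a \<Rightarrow> real) \<Rightarrow> ('a \<Rightarrow> complex) set" where
  "lpw p \<omega> = {f. (\<lambda>x. f x * complex_of_real (\<omega> x)) \<in> lp p}"

definition lpw_norm :: "real \<Rightarrow> ('a \<Rightarrow> real) \<Rightarrow> ('a \<Rightarrow> complex) \<Rightarrow> real" where
  "lpw_norm p \<omega> f = lp_norm p (\<lambda>x. f x * complex_of_real (\<omega> x))"


section \<open>Convolution and Banach \<open>*\<close>-algebras of functions\<close>

definition conv :: "('a::group_add \<Rightarrow> complex) \<Rightarrow> ('a \<Rightarrow> complex) \<Rightarrow> 'a \<Rightarrow> complex" where
  "conv f g = (\<lambda>x. \<Sum>\<^sub>\<infinity>y. f y * g (- y + x))"

definition star :: "('a::group_add \<Rightarrow> complex) \<Rightarrow> 'a \<Rightarrow> complex" where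
  "star f = (\<lambda>x. cnj (f (- x)))"

definition delta_e :: "'a::group_add \<Rightarrow> complex" where
  "delta_e = (\<lambda>x. if x = 0 then 1 else 0)"

definition banach_space_on :: "('a \<Rightarrow> complex) set \<Rightarrow> (('a \<Rightarrow> complex) \<Rightarrow> real) \<Rightarrow> bool" where
  "banach_space_on A N \<longleftrightarrow>
     (\<lambda>_. 0) \<in> A \<and>
     (\<forall>f\<in>A. \<forall>g\<in>A. (\<lambda>x. f x + g x) \<in> A) \<and>
     (\<forall>c. \<forall>f\<in>A. (\<lambda>x. c * f x) \<in> A) \<and>
     (\<forall>f\<in>A. 0 \<le> N f) \<and>
     (\<forall>f\<in>A. N f = 0 \<longleftrightarrow> f = (\<lambda>_. 0)) \<and>
     (\<forall>f\<in>A. \<forall>g\<in>A. N (\<lambda>x. f x + g x) \<le> N f + N g) \<and>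
     (\<forall>c. \<forall>f\<in>A. N (\<lambda>x. c * f x) = cmod c * N f) \<and>
     (\<forall>F::nat \<Rightarrow> 'a \<Rightarrow> complex. (\<forall>n. F n \<in> A) \<longrightarrow>
        (\<forall>\<epsilon>>0. \<exists>M. \<forall>m\<ge>M. \<forall>n\<ge>M. N (\<lambda>x. F m x - F n x) < \<epsilon>) \<longrightarrow>
        (\<exists>f\<in>A. (\<lambda>n. N (\<lambda>x. F n x - f x)) \<longlonglongrightarrow> 0))"

text \<open>
  The norm need only be submultiplicative up to a constant \<open>K\<close>. As \<^const>\<open>infsum\<close> is \<open>0\<close> for
  non-summable families, convergence of the convolution series is demanded explicitly.
\<close>

definition conv_banach_star_algebra ::
    "('a::group_add \<Rightarrow> complex) set \<Rightarrow> (('a \<Rightarrow> complex) \<Rightarrow> real) \<Rightarrow> bool" where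
  "conv_banach_star_algebra A N \<longleftrightarrow>
     banach_space_on A N \<and>
     (\<forall>f\<in>A. \<forall>g\<in>A. \<forall>x. (\<lambda>y. f y * g (- y + x)) summable_on UNIV) \<and>
     (\<forall>f\<in>A. \<forall>g\<in>A. conv f g \<in> A) \<and>
     (\<exists>K>0. \<forall>f\<in>A. \<forall>g\<in>A. N (conv f g) \<le> K * N f * N g) \<and>
     (\<forall>f\<in>A. \<forall>g\<in>A. \<forall>h\<in>A. conv (conv f g) h = conv f (conv g h)) \<and>
     (\<forall>f\<in>A. \<forall>g\<in>A. \<forall>h\<in>A. conv (\<lambda>x. f x + g x) h = (\<lambda>x. conv f h x + conv g h x)) \<and>
     (\<forall>f\<in>A. \<forall>g\<in>A. \<forall>h\<in>A. conv f (\<lambda>x. g x + h x) = (\<lambda>x. conv f g x + conv f h x)) \<and>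
     (\<forall>c. \<forall>f\<in>A. \<forall>g\<in>A. conv (\<lambda>x. c * f x) g = (\<lambda>x. c * conv f g x) \<and>
                          conv f (\<lambda>x. c * g x) = (\<lambda>x. c * conv f g x)) \<and>
     delta_e \<in> A \<and>
     (\<forall>f\<in>A. conv delta_e f = f \<and> conv f delta_e = f) \<and>
     (\<forall>f\<in>A. star f \<in> A \<and> N (star f) = N f \<and> star (star f) = f) \<and>
     (\<forall>f\<in>A. \<forall>g\<in>A. star (\<lambda>x. f x + g x) = (\<lambda>x. star f x + star g x)) \<and>
     (\<forall>c. \<forall>f\<in>A. star (\<lambda>x. c * f x) = (\<lambda>x. cnj c * star f x)) \<and>
     (\<forall>f\<in>A. \<forall>g\<in>A. star (conv f g) = conv (star g) (star f))"


section \<open>The Hilbert space \<open>\<ell>\<^sup>2(G)\<close> as a normed type\<close>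

lemma lp2_iff: "f \<in> lp 2 \<longleftrightarrow> (\<lambda>x. (norm (f x))\<^sup>2) summable_on UNIV"
  by (simp add: lp_def powr_numeral)

lemma lp2_norm: "lp_norm 2 f = sqrt (\<Sum>\<^sub>\<infinity>x. (norm (f x))\<^sup>2)"
  by (simp add: lp_norm_def powr_numeral powr_half_sqrt infsum_nonneg)

lemma L2_set_le_lp2_norm:
  assumes "f \<in> lp 2" "finite F"
  shows "L2_set (\<lambda>x. norm (f x)) F \<le> lp_norm 2 f"
  unfolding lp2_norm L2_set_def using assms
  by (intro real_sqrt_le_mono finite_sum_le_infsum) (auto simp: lp2_iff)

lemma lp2_boundI:
  assumes "\<And>F. finite F \<Longrightarrow> L2_set (\<lambda>x. norm (f x)) F \<le> B"
  shows "f \<in> lp 2" "lp_norm 2 f \<le> B"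
proof -
  have B: "0 \<le> B" using assms[of "{}"] by simp
  have b: "(\<Sum>x\<in>F. (norm (f x))\<^sup>2) \<le> B\<^sup>2" if "finite F" for F
    using assms[OF that] B unfolding L2_set_def by (metis sqrt_le_D)
  have s: "(\<lambda>x. (norm (f x))\<^sup>2) summable_on UNIV"
    using b by (intro nonneg_bdd_above_summable_on) (auto intro!: bdd_aboveI)
  then show "f \<in> lp 2" by (simp add: lp2_iff)
  have "(\<Sum>\<^sub>\<infinity>x. (norm (f x))\<^sup>2) \<le> B\<^sup>2"
    using b by (intro infsum_le_finite_sums[OF s]) auto
  then show "lp_norm 2 f \<le> B" unfolding lp2_norm using B real_le_lsqrt by blast
qed

lemma lp2_add:
  assumes "f \<in> lp 2" "g \<in> lp 2"
  shows "(\<lambda>x. f x + g x) \<in> lp 2" "lp_norm 2 (\<lambda>x. f x + g x) \<le> lp_norm 2 f + lp_norm 2 g"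
proof -
  have *: "L2_set (\<lambda>x. norm (f x + g x)) F \<le> lp_norm 2 f + lp_norm 2 g" if "finite F" for F
  proof -
    have "L2_set (\<lambda>x. norm (f x + g x)) F \<le> L2_set (\<lambda>x. norm (f x) + norm (g x)) F"
      by (intro L2_set_mono norm_triangle_ineq) auto
    also have "\<dots> \<le> L2_set (\<lambda>x. norm (f x)) F + L2_set (\<lambda>x. norm (g x)) F"
      by (rule L2_set_triangle_ineq)
    also have "\<dots> \<le> lp_norm 2 f + lp_norm 2 g"
      using assms that by (intro add_mono L2_set_le_lp2_norm)
    finally show ?thesis .
  qed
  show "(\<lambda>x. f x + g x) \<in> lp 2" "lp_norm 2 (\<lambda>x. f x + g x) \<le> lp_norm 2 f + lp_norm 2 g"
    by (rule lp2_boundI, erule *)+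
qed

lemma lp2_scaleR:
  fixes f :: "'a \<Rightarrow> 'b::real_normed_vector"
  assumes "f \<in> lp 2"
  shows "(\<lambda>x. r *\<^sub>R f x) \<in> lp 2" "lp_norm 2 (\<lambda>x. r *\<^sub>R f x) = \<bar>r\<bar> * lp_norm 2 f"
  using assms
  by (auto simp: lp2_iff lp2_norm power_mult_distrib summable_on_cmult_right
      infsum_cmult_right' real_sqrt_mult)

lemma lp2_norm_eq_0: "f \<in> lp 2 \<Longrightarrow> lp_norm 2 f = 0 \<longleftrightarrow> f = (\<lambda>_. 0)"
  using nonneg_infsum_le_0D[of "\<lambda>x. (norm (f x))\<^sup>2" UNIV]
  by (auto simp: lp2_iff lp2_norm infsum_nonneg)

typedef 'a ell2 = "lp 2 :: ('a \<Rightarrow> complex) set"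
  by (rule exI[of _ "\<lambda>_. 0"]) (simp add: lp2_iff)

setup_lifting type_definition_ell2

instantiation ell2 :: (type) real_normed_vector
begin

lift_definition zero_ell2 :: "'a ell2" is "\<lambda>_. 0" by (simp add: lp2_iff)
lift_definition plus_ell2 :: "'a ell2 \<Rightarrow> 'a ell2 \<Rightarrow> 'a ell2" is "\<lambda>f g x. f x + g x"
  by (rule lp2_add)
lift_definition uminus_ell2 :: "'a ell2 \<Rightarrow> 'a ell2" is "\<lambda>f x. - f x" by (simp add: lp2_iff)
lift_definition minus_ell2 :: "'a ell2 \<Rightarrow> 'a ell2 \<Rightarrow> 'a ell2" is "\<lambda>f g x. f x - g x"
  subgoal for f g using lp2_add(1)[of f "\<lambda>x. - g x"] by (simp add: lp2_iff) done
lift_definition scaleR_ell2 :: "real \<Rightarrow> 'a ell2 \<Rightarrow> 'a ell2" is "\<lambda>r f x. r *\<^sub>R f x"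
  by (rule lp2_scaleR)
lift_definition norm_ell2 :: "'a ell2 \<Rightarrow> real" is "lp_norm 2" .
definition sgn_ell2 :: "'a ell2 \<Rightarrow> 'a ell2" where "sgn_ell2 f = scaleR (inverse (norm f)) f"
definition dist_ell2 :: "'a ell2 \<Rightarrow> 'a ell2 \<Rightarrow> real" where "dist_ell2 f g = norm (f - g)"
definition uniformity_ell2 :: "('a ell2 \<times> 'a ell2) filter" where
  "uniformity_ell2 = (INF e\<in>{0<..}. principal {(f, g). dist f g < e})"
definition open_ell2 :: "'a ell2 set \<Rightarrow> bool" where
  "open_ell2 U \<longleftrightarrow> (\<forall>x\<in>U. eventually (\<lambda>(x', y). x' = x \<longrightarrow> y \<in> U) uniformity)"

instance
proof
  fix f g h :: "'a ell2" and r t :: real and U :: "'a ell2 set"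
  show "f + g + h = f + (g + h)" by transfer (simp add: add.assoc)
  show "f + g = g + f" by transfer (simp add: add.commute)
  show "0 + f = f" by transfer simp
  show "- f + f = 0" by transfer simp
  show "f - g = f + - g" by transfer simp
  show "r *\<^sub>R (f + g) = r *\<^sub>R f + r *\<^sub>R g" by transfer (simp add: algebra_simps)
  show "(r + t) *\<^sub>R f = r *\<^sub>R f + t *\<^sub>R f" by transfer (simp add: algebra_simps)
  show "r *\<^sub>R t *\<^sub>R f = (r * t) *\<^sub>R f" by transfer (simp add: algebra_simps)
  show "1 *\<^sub>R f = f" by transfer simp
  show "norm f = 0 \<longleftrightarrow> f = 0" by transfer (rule lp2_norm_eq_0)
  show "norm (f + g) \<le> norm f + norm g" by transfer (rule lp2_add)
  show "norm (r *\<^sub>R f) = \<bar>r\<bar> * norm f" by transfer (rule lp2_scaleR)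
qed (simp_all add: sgn_ell2_def dist_ell2_def uniformity_ell2_def open_ell2_def)

end


section \<open>The reduced \<open>C\<^sup>*\<close>-algebra\<close>

text \<open>\<open>f * g\<close> is a well-defined element of \<open>\<ell>\<^sup>2(G)\<close> for \<open>f \<in> \<ell>\<^sup>1(G)\<close> and \<open>g \<in> \<ell>\<^sup>2(G)\<close>.\<close>

lemma norm_le_lp2_norm: "g \<in> lp 2 \<Longrightarrow> norm (g x) \<le> lp_norm 2 g"
  using L2_set_le_lp2_norm[of g "{x}"] by simp

lemma lp1_iff: "f \<in> lp 1 \<longleftrightarrow> (\<lambda>x. norm (f x)) summable_on UNIV"
  by (simp add: lp_def)

lemma lp1_norm: "lp_norm 1 f = (\<Sum>\<^sub>\<infinity>x. norm (f x))"
  by (simp add: lp_norm_def infsum_nonneg)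

lemma conv_summable:
  fixes f g :: "'a::group_add \<Rightarrow> complex"
  assumes "f \<in> lp 1" "g \<in> lp 2"
  shows "(\<lambda>y. f y * g (- y + x)) summable_on UNIV"
proof -
  have "(\<lambda>y. norm (f y) * lp_norm 2 g) summable_on UNIV"
    using assms by (intro summable_on_cmult_left) (simp add: lp1_iff)
  then show ?thesis
    by (rule abs_summable_summable[OF Infinite_Sum.abs_summable_on_comparison_test'])
      (auto simp: norm_mult intro!: mult_left_mono norm_le_lp2_norm assms)
qed

lemma conv_lp2:
  fixes f g :: "'a::group_add \<Rightarrow> complex"
  assumes f: "f \<in> lp 1" and g: "g \<in> lp 2"
  shows "conv f g \<in> lp 2" "lp_norm 2 (conv f g) \<le> lp_norm 1 f * lp_norm 2 g"
proof -
  have *: "L2_set (\<lambda>x. norm (conv f g x)) F \<le> lp_norm 1 f * lp_norm 2 g" if F: "finite F" for F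
  proof (rule tendsto_upperbound)
    have "((\<lambda>Y. \<Sum>y\<in>Y. f y * g (- y + x)) \<longlongrightarrow> conv f g x) (finite_subsets_at_top UNIV)" for x
      using has_sum_infsum[OF conv_summable[OF f g]] by (simp add: conv_def has_sum_def)
    then show "((\<lambda>Y. L2_set (\<lambda>x. norm (\<Sum>y\<in>Y. f y * g (- y + x))) F)
        \<longlongrightarrow> L2_set (\<lambda>x. norm (conv f g x)) F) (finite_subsets_at_top UNIV)"
      unfolding L2_set_def by (intro tendsto_intros)
  next
    have shift: "L2_set (\<lambda>x. norm (g (- y + x))) F \<le> lp_norm 2 g" for y
    proof -
      have "L2_set (\<lambda>x. norm (g (- y + x))) F = L2_set (\<lambda>x. norm (g x)) ((\<lambda>x. - y + x) ` F)"
        unfolding L2_set_def by (subst sum.reindex) (auto simp: inj_on_def)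
      also have "\<dots> \<le> lp_norm 2 g" using g F by (intro L2_set_le_lp2_norm) auto
      finally show ?thesis .
    qed
    have "L2_set (\<lambda>x. norm (\<Sum>y\<in>Y. f y * g (- y + x))) F \<le> lp_norm 1 f * lp_norm 2 g"
      if Y: "finite Y" for Y
    proof -
      have "L2_set (\<lambda>x. norm (\<Sum>y\<in>Y. f y * g (- y + x))) F \<le> (\<Sum>y\<in>Y. norm (f y) * lp_norm 2 g)"
        using Y
      proof (induction Y)
        case empty then show ?case by (simp add: L2_set_def)
      next
        case (insert y Y)
        have "L2_set (\<lambda>x. norm (\<Sum>y\<in>insert y Y. f y * g (- y + x))) F
          \<le> L2_set (\<lambda>x. norm (f y) * norm (g (- y + x)) + norm (\<Sum>y\<in>Y. f y * g (- y + x))) F"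
          using insert.hyps
          by (intro L2_set_mono) (auto simp: norm_mult[symmetric] intro: norm_triangle_ineq)
        also have "\<dots> \<le> L2_set (\<lambda>x. norm (f y) * norm (g (- y + x))) F
            + L2_set (\<lambda>x. norm (\<Sum>y\<in>Y. f y * g (- y + x))) F"
          by (rule L2_set_triangle_ineq)
        also have "\<dots> \<le> norm (f y) * lp_norm 2 g + (\<Sum>y\<in>Y. norm (f y) * lp_norm 2 g)"
          using insert.IH shift[of y]
          by (intro add_mono) (auto simp flip: L2_set_right_distrib intro: mult_left_mono)
        finally show ?case using insert.hyps by simp
      qed
      also have "\<dots> \<le> lp_norm 1 f * lp_norm 2 g"
        unfolding sum_distrib_right[symmetric] lp1_norm using f Y
        by (intro mult_right_mono finite_sum_le_infsum)
          (auto simp: lp1_iff lp2_norm infsum_nonneg)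
      finally show ?thesis .
    qed
    then show "\<forall>\<^sub>F Y in finite_subsets_at_top UNIV.
        L2_set (\<lambda>x. norm (\<Sum>y\<in>Y. f y * g (- y + x))) F \<le> lp_norm 1 f * lp_norm 2 g"
      by (auto intro: eventually_finite_subsets_at_top_weakI)
  qed simp
  show "conv f g \<in> lp 2" "lp_norm 2 (conv f g) \<le> lp_norm 1 f * lp_norm 2 g"
    by (rule lp2_boundI, erule *)+
qed

text \<open>The operator \<open>g \<mapsto> f * g\<close> on \<open>\<ell>\<^sup>2(G)\<close>; it is used for \<open>f \<in> \<ell>\<^sup>1(G)\<close> only.\<close>

definition lreg :: "('a::group_add \<Rightarrow> complex) \<Rightarrow> 'a ell2 \<Rightarrow>\<^sub>L 'a ell2" where
  "lreg f = Blinfun (\<lambda>g. Abs_ell2 (conv f (Rep_ell2 g)))"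

lemma Rep_lreg:
  assumes f: "f \<in> lp 1"
  shows "Rep_ell2 (blinfun_apply (lreg f) g) = conv f (Rep_ell2 g)"
proof -
  have Rep: "Rep_ell2 (Abs_ell2 (conv f (Rep_ell2 g))) = conv f (Rep_ell2 g)" for g
    by (intro Abs_ell2_inverse conv_lp2 f Rep_ell2)
  have sm: "(\<lambda>y. f y * Rep_ell2 g (- y + x)) summable_on UNIV" for g x
    by (intro conv_summable f Rep_ell2)
  have "bounded_linear (\<lambda>g. Abs_ell2 (conv f (Rep_ell2 g)))"
  proof (rule bounded_linear_intro[where K = "lp_norm 1 f"])
    fix g h :: "'a ell2" and r :: real
    show "Abs_ell2 (conv f (Rep_ell2 (g + h)))
        = Abs_ell2 (conv f (Rep_ell2 g)) + Abs_ell2 (conv f (Rep_ell2 h))"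
      unfolding Rep_ell2_inject[symmetric] Rep
      by (simp add: plus_ell2.rep_eq Rep) (simp add: conv_def ring_distribs infsum_add sm)
    show "Abs_ell2 (conv f (Rep_ell2 (r *\<^sub>R g))) = r *\<^sub>R Abs_ell2 (conv f (Rep_ell2 g))"
      unfolding Rep_ell2_inject[symmetric] Rep
      by (simp add: scaleR_ell2.rep_eq Rep) (simp add: conv_def infsum_scaleR_right)
    show "norm (Abs_ell2 (conv f (Rep_ell2 g))) \<le> norm g * lp_norm 1 f"
      using conv_lp2(2)[OF f Rep_ell2[of g]] by (simp add: norm_ell2.rep_eq Rep mult.commute)
  qed
  then show ?thesis by (simp add: lreg_def bounded_linear_Blinfun_apply Rep)
qed

lemma lreg_inject:
  assumes "f \<in> lp 1" "g \<in> lp 1"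
  shows "lreg f = lreg g \<longleftrightarrow> f = g"
proof
  assume eq: "lreg f = lreg g"
  have d: "delta_e \<in> lp 2"
    unfolding lp2_iff by (rule finite_nonzero_values_imp_summable_on) (simp add: delta_e_def)
  have "conv h delta_e x = h x" for h :: "'a \<Rightarrow> complex" and x
  proof -
    have "conv h delta_e x = (\<Sum>\<^sub>\<infinity>y\<in>{x}. h y * delta_e (- y + x))"
      unfolding conv_def
      by (rule infsum_cong_neutral) (auto simp: delta_e_def neg_eq_iff_add_eq_0 [symmetric])
    then show ?thesis by (simp add: delta_e_def)
  qed
  then show "f = g"
    using Rep_lreg[OF assms(1), of "Abs_ell2 delta_e"] Rep_lreg[OF assms(2), of "Abs_ell2 delta_e"] eq
    by (simp add: Abs_ell2_inverse[OF d] fun_eq_iff)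
qed simp

text \<open>
  \<open>'a ell2 \<Rightarrow>\<^sub>L 'a ell2\<close> consists of the bounded real-linear operators with the operator norm. The
  complex-linear ones form a closed subspace containing every \<^term>\<open>lreg f\<close> with \<open>f \<in> \<ell>\<^sup>1(G)\<close>, so
  the closure below is the same as the closure in \<open>B(\<ell>\<^sup>2(G))\<close>.
\<close>

definition cstar_r :: "('a::group_add ell2 \<Rightarrow>\<^sub>L 'a ell2) set" where
  "cstar_r = closure (lreg ` lp 1)"


section \<open>Inverse-closedness and norm-controlled inversion\<close>

text \<open>
  An algebra \<open>A \<subseteq> \<ell>\<^sup>1(G)\<close> is regarded as a subalgebra of \<^const>\<open>cstar_r\<close> through \<^const>\<open>lreg\<close>, which
  is injective on \<open>\<ell>\<^sup>1(G)\<close>.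
\<close>

definition cstar_r_inverse :: "('a::group_add ell2 \<Rightarrow>\<^sub>L 'a ell2) \<Rightarrow> ('a ell2 \<Rightarrow>\<^sub>L 'a ell2) \<Rightarrow> bool" where
  "cstar_r_inverse S T \<longleftrightarrow> S \<in> cstar_r \<and> T \<in> cstar_r \<and>
     S o\<^sub>L T = id_blinfun \<and> T o\<^sub>L S = id_blinfun"

definition inverse_closed_in_cstar_r :: "('a::group_add \<Rightarrow> complex) set \<Rightarrow> bool" where
  "inverse_closed_in_cstar_r A \<longleftrightarrow> A \<subseteq> lp 1 \<and>
     (\<forall>f\<in>A. \<forall>T. cstar_r_inverse (lreg f) T \<longrightarrow> (\<exists>g\<in>A. T = lreg g))"

definition norm_controlled_inversion_in_cstar_r ::
    "('a::group_add \<Rightarrow> complex) set \<Rightarrow> (('a \<Rightarrow> complex) \<Rightarrow> real) \<Rightarrow> bool" where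
  "norm_controlled_inversion_in_cstar_r A N \<longleftrightarrow> inverse_closed_in_cstar_r A \<and>
     (\<exists>h::real \<Rightarrow> real \<Rightarrow> real. (\<forall>a\<ge>0. \<forall>b\<ge>0. 0 \<le> h a b) \<and>
        (\<forall>f\<in>A. \<forall>g\<in>A. cstar_r_inverse (lreg f) (lreg g) \<longrightarrow> N g \<le> h (N f) (norm (lreg g))))"

end

(* For \<theta> > 0 small, Young's inequality interpolates the weighted \<ell>\<^sup>1 norm of f between its sup norm and its
   \<ell>\<^sup>p(G, \<omega>) norm N:
     \<Sum>\<bar>f\<bar> \<omega> u \<le> C \<parallel>f\<parallel>\<^sub>\<infinity>^\<theta> N(f)^(1 - \<theta>),
   and the sup norm is at most the operator norm \<parallel>\<lambda>(f)\<parallel>. Together with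
     N(f * g) \<le> (\<Sum>\<bar>f\<bar> \<omega> u) N(g) + N(f) (\<Sum>\<bar>g\<bar> \<omega> u)
   this makes \<ell>\<^sup>p(G, \<omega>) a Banach algebra inside \<ell>\<^sup>1(G) with N(f * f) \<le> 2 C \<parallel>\<lambda>(f)\<parallel>^\<theta> N(f)^(2 - \<theta>).
   If \<parallel>\<lambda>(b)\<parallel> \<le> \<rho> < 1, this inequality applied to the powers of b bounds the Neumann series \<Sum> b^n in
   \<ell>\<^sup>p(G, \<omega>) by a number depending on N(b) and \<rho> only; it is applied to a multiple of f^* * f. *)
theory Submission
  imports Defs
begin

section \<open>The spaces \<open>\<ell>\<^sup>p\<close>\<close>

text \<open>The source of a positive \<theta> is the strict inequality s < q. At \<theta> = 0 the
  estimate would be Hoelder's inequality with u in l^q; the gap between s and q, together with the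
  factor \<omega>^r, pays for using \<bar>f\<bar>^\<theta> in place of (\<bar>f\<bar>
  \<omega>)^\<theta>. However small \<theta> is, it suffices: k doublings raise the constants to
  powers of order (2 - \<theta>)^k, which is negligible against 2^k, so N(b^n) decays although only
  the operator norm of b is below 1. The other concern is uniformity. The final bound may depend on
  f through N(f) and the norm of the inverse only. Hence the operator norm of f is replaced by its
  majorant (C/c) N(f), where c is the lower bound of \<omega> u, and the Neumann argument is carried
  out for numerical sequences that stand for N(b^n), so that its bound is fixed before b is.
  Spectral theory does not enter. That b = 1 - (star f)f/M has norm below 1 follows from expanding a
  square in l^2(G), where the adjoint of convolution by f is convolution by
  \<open>star f\<close>.\<close>

lemma lp_norm_nonneg: "0 \<le> lp_norm p f"
  by (simp add: lp_norm_def)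

lemma lp_norm_powr:
  assumes "0 < p"
  shows "lp_norm p f powr p = (\<Sum>\<^sub>\<infinity>x. norm (f x) powr p)"
  using assms by (simp add: lp_norm_def powr_powr infsum_nonneg)

lemma sum_powr_le_lp_norm:
  assumes "0 < p" "f \<in> lp p" "finite X"
  shows "(\<Sum>x\<in>X. norm (f x) powr p) \<le> lp_norm p f powr p"
  unfolding lp_norm_powr[OF assms(1)] using assms
  by (intro finite_sum_le_infsum) (auto simp: lp_def)

lemma norm_le_lp_norm:
  assumes "0 < p" "f \<in> lp p"
  shows "norm (f x) \<le> lp_norm p f"
  using sum_powr_le_lp_norm[OF assms, of "{x}"] assms(1) lp_norm_nonneg[of p f]
  by (simp add: powr_mono_both' powr_le_cancel_iff) (meson linorder_not_le norm_ge_zero powr_less_mono2)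

text \<open>Bounds on finite partial sums give membership together with the norm bound. A bound on
  \<open>lp_norm\<close> alone says nothing about membership, as \<open>infsum\<close> is 0 on
  nonsummable families.\<close>

lemma lp_boundI:
  assumes "0 < p" "0 \<le> B" "\<And>X. finite X \<Longrightarrow> (\<Sum>x\<in>X. norm (f x) powr p) \<le> B powr p"
  shows "f \<in> lp p \<and> lp_norm p f \<le> B"
proof
  show f: "f \<in> lp p"
    unfolding lp_def using assms(3)
    by (auto intro!: nonneg_bdd_above_summable_on bdd_aboveI)
  have "(\<Sum>\<^sub>\<infinity>x. norm (f x) powr p) \<le> B powr p"
    using f assms(3) by (intro infsum_le_finite_sums) (auto simp: lp_def)
  then have "lp_norm p f \<le> (B powr p) powr (1 / p)"
    unfolding lp_norm_def using assms(1) by (intro powr_mono2) (auto simp: infsum_nonneg)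
  then show "lp_norm p f \<le> B" using assms(1,2) by (simp add: powr_powr)
qed

lemma lp_dominated:
  assumes "0 < p" "f \<in> lp p" "\<And>x. norm (g x) \<le> norm (f x)"
  shows "g \<in> lp p \<and> lp_norm p g \<le> lp_norm p f"
proof (rule lp_boundI[OF assms(1) lp_norm_nonneg])
  fix X :: "'a set" assume X: "finite X"
  have "(\<Sum>x\<in>X. norm (g x) powr p) \<le> (\<Sum>x\<in>X. norm (f x) powr p)"
    using assms(1,3) by (intro sum_mono powr_mono2) auto
  also have "\<dots> \<le> lp_norm p f powr p" by (rule sum_powr_le_lp_norm[OF assms(1,2) X])
  finally show "(\<Sum>x\<in>X. norm (g x) powr p) \<le> lp_norm p f powr p" .
qed

text \<open>On a fixed finite set the sum of p-th powers depends continuously on the values, so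
  pointwise convergence preserves the bound. The filter is arbitrary because the lemma serves both
  nets of finite partial sums and Cauchy sequences.\<close>

lemma lp_fatou:
  assumes "0 < p" "0 \<le> B" "\<F> \<noteq> bot"
    and lim: "\<And>x. ((\<lambda>i. f i x) \<longlongrightarrow> g x) \<F>"
    and bd: "eventually (\<lambda>i. f i \<in> lp p \<and> lp_norm p (f i) \<le> B) \<F>"
  shows "g \<in> lp p \<and> lp_norm p g \<le> B"
proof (rule lp_boundI[OF assms(1,2)])
  fix X :: "'b set" assume X: "finite X"
  show "(\<Sum>x\<in>X. norm (g x) powr p) \<le> B powr p"
  proof (rule tendsto_upperbound[OF _ _ assms(3)])
    show "((\<lambda>i. \<Sum>x\<in>X. norm (f i x) powr p) \<longlongrightarrow> (\<Sum>x\<in>X. norm (g x) powr p)) \<F>"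
      using assms(1) by (intro tendsto_sum tendsto_powr' tendsto_norm lim tendsto_const) auto
    show "\<forall>\<^sub>F i in \<F>. (\<Sum>x\<in>X. norm (f i x) powr p) \<le> B powr p"
      using bd
    proof eventually_elim
      case (elim i)
      have "(\<Sum>x\<in>X. norm (f i x) powr p) \<le> lp_norm p (f i) powr p"
        using elim X assms(1) by (intro sum_powr_le_lp_norm) auto
      also have "\<dots> \<le> B powr p" using elim assms(1) lp_norm_nonneg by (intro powr_mono2) auto
      finally show ?case .
    qed
  qed
qed

lemma lp_scale:
  fixes f :: "'a \<Rightarrow> 'b::real_normed_div_algebra"
  assumes "0 < p" "f \<in> lp p"
  shows "(\<lambda>x. c * f x) \<in> lp p" "lp_norm p (\<lambda>x. c * f x) = norm c * lp_norm p f"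
  using assms
  by (auto simp: lp_def lp_norm_def norm_mult powr_mult summable_on_cmult_right infsum_cmult_right'
     powr_powr infsum_nonneg)

lemma lp_zero: "0 < p \<Longrightarrow> (\<lambda>_. 0) \<in> lp p \<and> lp_norm p (\<lambda>_. 0) = 0"
  by (simp add: lp_def lp_norm_def)

lemma lp_norm_eq_0:
  assumes "0 < p" "f \<in> lp p" "lp_norm p f = 0"
  shows "f = (\<lambda>_. 0)"
  using norm_le_lp_norm[OF assms(1,2)] assms(3) by (auto simp: fun_eq_iff)

lemma powr_convex_combination:
  fixes a b p :: real
  assumes "1 \<le> p" "0 \<le> a" "0 \<le> b" "0 \<le> l" "l \<le> 1"
  shows "(l * a + (1 - l) * b) powr p \<le> l * a powr p + (1 - l) * b powr p"
proof (cases "a = 0 \<or> b = 0")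
  case True
  have *: "(m * c) powr p \<le> m * c powr p" if "0 \<le> m" "m \<le> 1" "0 \<le> c" for m c :: real
  proof -
    have "m powr p \<le> m powr 1"
      using that assms(1) powr_mono'[of 1 p m] by simp
    then have "m powr p \<le> m" using that by simp
    then show ?thesis using that by (simp add: powr_mult mult_right_mono)
  qed
  show ?thesis using True *[of l a] *[of "1 - l" b] assms by auto
next
  case False
  then show ?thesis
    using convex_onD[OF powr_convex[OF assms(1)], of "1 - l" a b] assms by (simp add: algebra_simps)
qed

text \<open>After normalisation, f + g is F + G times a convex combination of the unit vectors f/F
  and g/G with weights F/(F + G) and G/(F + G). Convexity of the p-th power, summed over a finite
  set, gives the bound; a vanishing norm has to be split off before dividing.\<close>

lemma lp_triangle:
  assumes p: "1 \<le> p" and f: "f \<in> lp p" and g: "g \<in> lp p"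
  shows "(\<lambda>x. f x + g x) \<in> lp p \<and> lp_norm p (\<lambda>x. f x + g x) \<le> lp_norm p f + lp_norm p g"
proof (cases "lp_norm p f = 0 \<or> lp_norm p g = 0")
  case True
  then show ?thesis
    using lp_norm_eq_0[OF _ f] lp_norm_eq_0[OF _ g] f g p lp_norm_nonneg by auto
next
  case False
  define F G where "F = lp_norm p f" and "G = lp_norm p g"
  have F: "F > 0" and G: "G > 0" using False lp_norm_nonneg[of p] by (auto simp: F_def G_def less_le)
  have p0: "0 < p" using p by simp
  show ?thesis unfolding F_def[symmetric] G_def[symmetric]
  proof (rule lp_boundI[OF p0])
    show "0 \<le> F + G" using F G by simp
    fix X :: "'a set" assume X: "finite X"
    define l where "l = F / (F + G)"
    have l: "0 \<le> l" "l \<le> 1" "1 - l = G / (F + G)" using F G by (auto simp: l_def field_simps)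
    have "norm (f x + g x) powr p
        \<le> (F + G) powr p * (l * (norm (f x) powr p / F powr p) + (1 - l) * (norm (g x) powr p / G powr p))" for x
    proof -
      have "norm (f x + g x) \<le> (F + G) * (l * (norm (f x) / F) + (1 - l) * (norm (g x) / G))"
      proof -
        have "(F + G) * l = F" "(F + G) * (1 - l) = G" unfolding l(3) using F G by (auto simp: l_def)
        then have e: "(F + G) * (l * a + (1 - l) * b) = F * a + G * b" for a b
          by (simp only: distrib_left mult.assoc[symmetric])
        show ?thesis unfolding e using F G norm_triangle_ineq[of "f x" "g x"] by simp
      qed
      then have "norm (f x + g x) powr p \<le> \<dots> powr p" using p0 by (intro powr_mono2) auto
      also have "\<dots> = (F + G) powr p * (l * (norm (f x) / F) + (1 - l) * (norm (g x) / G)) powr p"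
        using F G l by (intro powr_mult)
      also have "\<dots> \<le> (F + G) powr p * (l * (norm (f x) / F) powr p + (1 - l) * (norm (g x) / G) powr p)"
        using F G l p by (intro mult_left_mono powr_convex_combination) auto
      finally show ?thesis using F G by (simp add: powr_divide)
    qed
    then have "(\<Sum>x\<in>X. norm (f x + g x) powr p) \<le> (\<Sum>x\<in>X. (F + G) powr p *
        (l * (norm (f x) powr p / F powr p) + (1 - l) * (norm (g x) powr p / G powr p)))"
      by (intro sum_mono)
    also have "\<dots> = (F + G) powr p * (l * ((\<Sum>x\<in>X. norm (f x) powr p) / F powr p)
        + (1 - l) * ((\<Sum>x\<in>X. norm (g x) powr p) / G powr p))"
      by (simp add: sum_distrib_left[symmetric] sum.distrib sum_divide_distrib[symmetric])
    also have "\<dots> \<le> (F + G) powr p * (l * 1 + (1 - l) * 1)"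
      using F G l sum_powr_le_lp_norm[OF p0 f X] sum_powr_le_lp_norm[OF p0 g X]
      by (intro mult_left_mono add_mono) (auto simp: F_def G_def)
    finally show "(\<Sum>x\<in>X. norm (f x + g x) powr p) \<le> (F + G) powr p" by simp
  qed
qed

text \<open>Finite combinations follow from the triangle inequality by induction, and
  \<open>lp_fatou\<close> passes to the limit over finite index sets. With translates of one
  function as \<open>h y\<close> this is Young's inequality for the convolution of l^1 with
  l^p.\<close>

lemma lp_minkowski:
  fixes h :: "'i \<Rightarrow> 'a \<Rightarrow> real" and c :: "'i \<Rightarrow> real"
  assumes p: "1 \<le> p" and c: "\<And>y. 0 \<le> c y" "c summable_on UNIV"
    and h: "\<And>y. h y \<in> lp p" "\<And>y. lp_norm p (h y) \<le> H" and H: "0 \<le> H"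
  shows "(\<lambda>y. c y * h y x) summable_on UNIV"
    and "(\<lambda>x. \<Sum>\<^sub>\<infinity>y. c y * h y x) \<in> lp p \<and> lp_norm p (\<lambda>x. \<Sum>\<^sub>\<infinity>y. c y * h y x) \<le> infsum c UNIV * H"
proof -
  have p0: "0 < p" using p by simp
  have bd: "norm (h y x) \<le> H" for y x
    using norm_le_lp_norm[OF p0 h(1)[of y], of x] h(2)[of y] by linarith
  have sm: "(\<lambda>y. c y * h y x) summable_on UNIV" for x
    by (rule abs_summable_summable[OF Infinite_Sum.abs_summable_on_comparison_test'[where g = "\<lambda>y. c y * H"]])
      (use c bd in \<open>auto simp: norm_mult abs_mult intro!: summable_on_cmult_left mult_left_mono\<close>)
  show "(\<lambda>y. c y * h y x) summable_on UNIV" by (rule sm)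
  show "(\<lambda>x. \<Sum>\<^sub>\<infinity>y. c y * h y x) \<in> lp p \<and> lp_norm p (\<lambda>x. \<Sum>\<^sub>\<infinity>y. c y * h y x) \<le> infsum c UNIV * H"
  proof (rule lp_fatou[OF p0, where \<F> = "finite_subsets_at_top UNIV"])
    show "0 \<le> infsum c UNIV * H" using c H by (simp add: infsum_nonneg)
    show "((\<lambda>Y. \<Sum>y\<in>Y. c y * h y x) \<longlongrightarrow> (\<Sum>\<^sub>\<infinity>y. c y * h y x)) (finite_subsets_at_top UNIV)" for x
      using has_sum_infsum[OF sm] by (simp add: has_sum_def)
    have "(\<lambda>x. \<Sum>y\<in>Y. c y * h y x) \<in> lp p \<and> lp_norm p (\<lambda>x. \<Sum>y\<in>Y. c y * h y x) \<le> sum c Y * H"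
      if "finite Y" for Y
      using that
    proof induction
      case empty then show ?case by (simp add: lp_zero[OF p0])
    next
      case (insert y Y)
      have 1: "(\<lambda>x. c y * h y x) \<in> lp p" "lp_norm p (\<lambda>x. c y * h y x) \<le> c y * H"
        using lp_scale[OF p0 h(1)[of y], of "c y"] c(1)[of y] h(2)[of y] by (auto intro: mult_left_mono)
      show ?case
        using lp_triangle[OF p 1(1) conjunct1[OF insert.IH]] 1(2) insert by (auto simp: algebra_simps)
    qed
    moreover have "sum c Y * H \<le> infsum c UNIV * H" if "finite Y" for Y
      using c H that by (intro mult_right_mono finite_sum_le_infsum) auto
    ultimately show "\<forall>\<^sub>F Y in finite_subsets_at_top UNIV. (\<lambda>x. \<Sum>y\<in>Y. c y * h y x) \<in> lp p \<and>
        lp_norm p (\<lambda>x. \<Sum>y\<in>Y. c y * h y x) \<le> infsum c UNIV * H"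
      by (intro eventually_finite_subsets_at_top_weakI) (meson order_trans)
  qed simp
qed

lemma lp_reindex:
  assumes "bij \<phi>"
  shows "(\<lambda>x. f (\<phi> x)) \<in> lp p \<longleftrightarrow> f \<in> lp p" "lp_norm p (\<lambda>x. f (\<phi> x)) = lp_norm p f"
  unfolding lp_def lp_norm_def using assms
    summable_on_reindex_bij_betw[of \<phi> UNIV UNIV "\<lambda>x. norm (f x) powr p"]
    infsum_reindex_bij_betw[of \<phi> UNIV UNIV "\<lambda>x. norm (f x) powr p"]
  by auto

section \<open>Convolution operators\<close>

lemma bij_add_left: "bij (\<lambda>x::'a::group_add. a + x)"
  by (rule bij_betw_byWitness[where f' = "\<lambda>x. - a + x"]) (auto simp: add.assoc[symmetric])

lemma bij_add_right: "bij (\<lambda>x::'a::group_add. x + a)"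
  by (rule bij_betw_byWitness[where f' = "\<lambda>x. x + - a"]) (auto simp: add.assoc)

lemma bij_diff_right: "bij (\<lambda>x::'a::group_add. x - a)"
  using bij_add_right[of "- a"] by simp

lemma bij_uminus_group: "bij (uminus :: 'a::group_add \<Rightarrow> 'a)"
  by (rule bij_betw_byWitness[where f' = uminus]) auto

lemma bij_uminus_add: "bij (\<lambda>x::'a::group_add. - x + a)"
  using bij_comp[OF bij_uminus_group bij_add_right[of a]] by (simp add: o_def)

lemma conv_summable_bounded:
  fixes f g :: "'a::group_add \<Rightarrow> complex"
  assumes "f \<in> lp 1" "\<And>x. norm (g x) \<le> B"
  shows "(\<lambda>y. f y * g (- y + x)) summable_on UNIV"
proof (rule abs_summable_summable[OF Infinite_Sum.abs_summable_on_comparison_test'])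
  show "(\<lambda>y. norm (f y) * B) summable_on UNIV"
    using assms(1) by (intro summable_on_cmult_left) (simp add: lp1_iff)
qed (auto simp: norm_mult intro!: mult_left_mono assms(2))

text \<open>Fubini for the double family \<open>F\<close>, dominated by
  \<open>norm (f z) * norm (g (- z + y)) * B\<close>. A bounded \<open>h\<close> covers two uses:
  \<open>h\<close> in l^2(G), which makes \<open>lreg\<close> multiplicative, and \<open>h\<close>
  in the algebra itself.\<close>

lemma conv_assoc:
  fixes f g h :: "'a::group_add \<Rightarrow> complex"
  assumes f: "f \<in> lp 1" and g: "g \<in> lp 1" and h: "\<And>x. norm (h x) \<le> B"
  shows "conv (conv f g) h = conv f (conv g h)"
proof
  fix x
  define F where "F = (\<lambda>z y. f z * g (- z + y) * h (- y + x))"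
  have gs: "(\<lambda>y. norm (g (- z + y))) summable_on UNIV" 
    "(\<Sum>\<^sub>\<infinity>y. norm (g (- z + y))) = (\<Sum>\<^sub>\<infinity>y. norm (g y))" for z
    using g summable_on_reindex_bij_betw[OF bij_add_left[of "- z"], of "\<lambda>y. norm (g y)"]
      infsum_reindex_bij_betw[OF bij_add_left[of "- z"], of "\<lambda>y. norm (g y)"]
    by (auto simp: lp1_iff)
  have "(\<lambda>(z, y). norm (f z) * norm (g (- z + y)) * B) summable_on UNIV \<times> UNIV"
  proof (rule summable_on_SigmaI)
    show "((\<lambda>y. case (z, y) of (z, y) \<Rightarrow> norm (f z) * norm (g (- z + y)) * B)
        has_sum (norm (f z) * (\<Sum>\<^sub>\<infinity>y. norm (g y)) * B)) UNIV" for z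
      using has_sum_infsum[OF gs(1)[of z]] gs(2)[of z]
      by (auto intro!: has_sum_cmult_left has_sum_cmult_right)
    show "(\<lambda>z. norm (f z) * (\<Sum>\<^sub>\<infinity>y. norm (g y)) * B) summable_on UNIV"
      using f by (intro summable_on_cmult_left) (simp add: lp1_iff)
    have "0 \<le> B" using h[of 0] norm_ge_zero order_trans by blast
    then show "\<And>z y. 0 \<le> (case (z, y) of (z, y) \<Rightarrow> norm (f z) * norm (g (- z + y)) * B)"
      by auto
  qed
  then have "(\<lambda>(z, y). F z y) summable_on UNIV \<times> UNIV"
    by (rule abs_summable_summable[OF Infinite_Sum.abs_summable_on_comparison_test'])
      (auto simp: F_def norm_mult intro!: mult_left_mono h)
  then have "(\<Sum>\<^sub>\<infinity>z. \<Sum>\<^sub>\<infinity>y. F z y) = (\<Sum>\<^sub>\<infinity>y. \<Sum>\<^sub>\<infinity>z. F z y)"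
    by (rule infsum_swap_banach)
  moreover have "(\<Sum>\<^sub>\<infinity>y. \<Sum>\<^sub>\<infinity>z. F z y) = conv (conv f g) h x"
    by (simp add: F_def conv_def infsum_cmult_left')
  moreover have "(\<Sum>\<^sub>\<infinity>y. F z y) = f z * conv g h (- z + x)" for z
    using infsum_reindex_bij_betw[OF bij_add_left[of "- z"], of "\<lambda>w. g w * h (- w + (- z + x))"]
    by (simp add: F_def conv_def infsum_cmult_right' minus_add add.assoc mult.assoc)
  ultimately show "conv (conv f g) h x = conv f (conv g h) x"
    by (simp add: conv_def)
qed

lemma conv_flip:
  fixes f g :: "'a::group_add \<Rightarrow> complex"
  shows "conv f g x = (\<Sum>\<^sub>\<infinity>z. f (x - z) * g z)"
  using infsum_reindex_bij_betw[OF bij_uminus_add[of x], of "\<lambda>z. f (x - z) * g z"]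
  by (simp add: conv_def diff_conv_add_uminus minus_add add.assoc[symmetric] del: add_uminus_conv_diff)

text \<open>Both sides are the same family up to conjugation and a bijection of the index, so they
  agree also where \<open>infsum\<close> takes its default value 0.\<close>

lemma star_conv: "star (conv f g) = conv (star g) (star f)"
proof
  fix x
  have "star (conv f g) x = (\<Sum>\<^sub>\<infinity>y. cnj (f y) * cnj (g (- y - x)))"
    by (simp add: star_def conv_def infsum_cnj[symmetric])
  also have "\<dots> = (\<Sum>\<^sub>\<infinity>z. star g (x - z) * star f z)"
    using infsum_reindex_bij_betw[OF bij_uminus_group, of "\<lambda>y. cnj (f y) * cnj (g (- y - x))"]
    by (simp add: star_def mult.commute)
  finally show "star (conv f g) x = conv (star g) (star f) x" by (simp add: conv_flip)
qed

lemma star_star: "star (star f) = f"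
  by (simp add: star_def fun_eq_iff)

lemma conv_lp1:
  fixes f g :: "'a::group_add \<Rightarrow> complex"
  assumes f: "f \<in> lp 1" and g: "g \<in> lp 1"
  shows "conv f g \<in> lp 1" "lp_norm 1 (conv f g) \<le> lp_norm 1 f * lp_norm 1 g"
proof -
  let ?h = "\<lambda>y x. norm (g (- y + x))"
  have h: "?h y \<in> lp 1" "lp_norm 1 (?h y) \<le> lp_norm 1 g" for y
    using g lp_reindex[where \<phi> = "\<lambda>x. - y + x" and f = "\<lambda>x. norm (g x)" and p = 1, OF bij_add_left]
    by (auto simp: lp1_iff lp1_norm)
  have c: "(\<lambda>y. norm (f y)) summable_on UNIV" using f by (simp add: lp1_iff)
  have k: "(\<lambda>x. \<Sum>\<^sub>\<infinity>y. norm (f y) * ?h y x) \<in> lp 1 \<and>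
      lp_norm 1 (\<lambda>x. \<Sum>\<^sub>\<infinity>y. norm (f y) * ?h y x) \<le> lp_norm 1 f * lp_norm 1 g"
    using lp_minkowski(2)[of 1 "\<lambda>y. norm (f y)" ?h "lp_norm 1 g", OF _ _ c h lp_norm_nonneg]
    by (simp add: lp1_norm)
  have "norm (conv f g x) \<le> norm (\<Sum>\<^sub>\<infinity>y. norm (f y) * ?h y x)" for x
  proof -
    have "(\<lambda>y. norm (f y * g (- y + x))) summable_on UNIV"
      using lp_minkowski(1)[of 1 "\<lambda>y. norm (f y)" ?h "lp_norm 1 g", OF _ _ c h lp_norm_nonneg]
      by (simp add: norm_mult)
    then show ?thesis
      using norm_infsum_bound[of "\<lambda>y. f y * g (- y + x)" UNIV]
      by (simp add: conv_def norm_mult abs_of_nonneg[OF infsum_nonneg])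
  qed
  from lp_dominated[OF _ conjunct1[OF k] this] k
  show "conv f g \<in> lp 1" "lp_norm 1 (conv f g) \<le> lp_norm 1 f * lp_norm 1 g" by auto
qed

lemma conv_delta_left: "conv delta_e f = f"
proof
  fix x
  have "conv delta_e f x = (\<Sum>\<^sub>\<infinity>y\<in>{0}. delta_e y * f (- y + x))"
    unfolding conv_def by (rule infsum_cong_neutral) (auto simp: delta_e_def)
  then show "conv delta_e f x = f x" by (simp add: delta_e_def)
qed

lemma star_delta: "star delta_e = delta_e"
  by (auto simp: star_def delta_e_def)

lemma conv_delta_right: "conv f delta_e = f"
  using star_conv[of delta_e "star f"] by (simp add: star_delta conv_delta_left star_star)

lemma delta_lp:
  assumes "0 < p"
  shows "(delta_e :: 'a::group_add \<Rightarrow> complex) \<in> lp p" "lp_norm p (delta_e :: 'a::group_add \<Rightarrow> complex) = 1"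
proof -
  have "(\<Sum>\<^sub>\<infinity>x::'a. norm (delta_e x :: complex) powr p) = (\<Sum>\<^sub>\<infinity>x\<in>{0::'a}. norm (delta_e x) powr p)"
    by (rule infsum_cong_neutral) (auto simp: delta_e_def)
  then show "lp_norm p (delta_e :: 'a \<Rightarrow> complex) = 1" by (simp add: lp_norm_def delta_e_def)
  have "{x::'a. norm (delta_e x) powr p \<noteq> 0} \<subseteq> {0}" by (auto simp: delta_e_def)
  then have "finite {x::'a. norm (delta_e x) powr p \<noteq> 0}" by (rule finite_subset) simp
  then show "(delta_e :: 'a \<Rightarrow> complex) \<in> lp p"
    unfolding lp_def by (auto intro!: finite_nonzero_values_imp_summable_on)
qed

section \<open>The left regular representation of l^1(G)\<close>

lemma lp1_add:
  assumes "f \<in> lp 1" "g \<in> lp 1"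
  shows "(\<lambda>x. f x + g x) \<in> lp 1"
  using lp_triangle[OF _ assms] by simp

lemma lreg_add:
  assumes "f \<in> lp 1" "g \<in> lp 1"
  shows "lreg (\<lambda>x. f x + g x) = lreg f + lreg g"
proof (rule blinfun_eqI)
  fix h :: "'a ell2"
  have "Rep_ell2 (lreg (\<lambda>x. f x + g x) h) = Rep_ell2 ((lreg f + lreg g) h)"
    unfolding Rep_lreg[OF lp1_add[OF assms]] blinfun.add_left plus_ell2.rep_eq
      Rep_lreg[OF assms(1)] Rep_lreg[OF assms(2)]
    by (simp add: conv_def ring_distribs infsum_add conv_summable[OF _ Rep_ell2] assms)
  then show "lreg (\<lambda>x. f x + g x) h = (lreg f + lreg g) h" by (simp only: Rep_ell2_inject)
qed

lemma lreg_scaleR: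
  assumes "f \<in> lp 1"
  shows "lreg (\<lambda>x. complex_of_real r * f x) = r *\<^sub>R lreg f"
proof (rule blinfun_eqI)
  fix h :: "'a ell2"
  have "Rep_ell2 (lreg (\<lambda>x. complex_of_real r * f x) h) = Rep_ell2 ((r *\<^sub>R lreg f) h)"
    unfolding Rep_lreg[OF lp_scale(1)[OF zero_less_one assms]] blinfun.scaleR_left scaleR_ell2.rep_eq
      Rep_lreg[OF assms(1)]
    by (simp add: conv_def infsum_cmult_right' mult.assoc scaleR_conv_of_real)
  then show "lreg (\<lambda>x. complex_of_real r * f x) h = (r *\<^sub>R lreg f) h" by (simp only: Rep_ell2_inject)
qed

lemma lreg_conv:
  assumes "f \<in> lp 1" "g \<in> lp 1"
  shows "lreg (conv f g) = lreg f o\<^sub>L lreg g"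
proof (rule blinfun_eqI)
  fix h :: "'a ell2"
  have "Rep_ell2 (lreg (conv f g) h) = Rep_ell2 ((lreg f o\<^sub>L lreg g) h)"
    using conv_assoc[OF assms norm_le_lp2_norm[OF Rep_ell2[of h]]]
    by (simp add: Rep_lreg conv_lp1 assms)
  then show "lreg (conv f g) h = (lreg f o\<^sub>L lreg g) h" by (simp only: Rep_ell2_inject)
qed

lemma lreg_delta: "lreg delta_e = id_blinfun"
  by (rule blinfun_eqI)
    (simp add: Rep_ell2_inject[symmetric] Rep_lreg delta_lp conv_delta_left)

lemma norm_lreg_le:
  assumes "f \<in> lp 1"
  shows "norm (lreg f) \<le> lp_norm 1 f"
  by (rule norm_blinfun_bound)
    (simp_all add: lp_norm_nonneg norm_ell2.rep_eq Rep_lreg[OF assms] conv_lp2[OF assms Rep_ell2])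

text \<open>Applying \<open>lreg f\<close> to the unit vector \<open>delta_e\<close> returns f, so
  the operator norm dominates the l^2 norm of f, which dominates each value.\<close>

lemma norm_le_norm_lreg:
  assumes "f \<in> lp 1"
  shows "norm (f x) \<le> norm (lreg f)"
proof -
  define d :: "'a ell2" where "d = Abs_ell2 delta_e"
  have R: "Rep_ell2 d = delta_e" by (simp add: d_def Abs_ell2_inverse delta_lp)
  have "norm (lreg f d) \<le> norm (lreg f) * norm d" by (rule norm_blinfun)
  then have "lp_norm 2 f \<le> norm (lreg f)"
    by (simp add: norm_ell2.rep_eq R Rep_lreg[OF assms] conv_delta_right delta_lp)
  moreover have "f \<in> lp 2"
    using Rep_ell2[of "lreg f d"] by (simp add: Rep_lreg[OF assms] R conv_delta_right)
  ultimately show ?thesis using norm_le_lp2_norm[of f x] by linarith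
qed

section \<open>Inner product on l^2(G), adjoints and a positivity estimate\<close>

lemma ell2_inner_summable:
  assumes "f \<in> lp 2" "g \<in> lp 2"
  shows "(\<lambda>x. f x * cnj (g x)) summable_on UNIV"
proof (rule abs_summable_summable[OF Infinite_Sum.abs_summable_on_comparison_test'])
  show "(\<lambda>x. (norm (f x))\<^sup>2 + (norm (g x))\<^sup>2) summable_on UNIV"
    using assms by (intro summable_on_add) (auto simp: lp2_iff)
  show "norm (f x * cnj (g x)) \<le> (norm (f x))\<^sup>2 + (norm (g x))\<^sup>2" for x
    using sum_squares_bound[of "norm (f x)" "norm (g x)"]
      mult_nonneg_nonneg[OF norm_ge_zero[of "f x"] norm_ge_zero[of "g x"]]
    unfolding norm_mult complex_mod_cnj by linarith
qed

instantiation ell2 :: (type) real_inner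
begin

text \<open>The real part of the Hermitian product: the operators in \<open>blinfun\<close> are
  real-linear, so the real Hilbert space structure is the one at hand. It induces the given
  norm.\<close>

definition inner_ell2 :: "'a ell2 \<Rightarrow> 'a ell2 \<Rightarrow> real" where
  "inner_ell2 f g = Re (\<Sum>\<^sub>\<infinity>x. Rep_ell2 f x * cnj (Rep_ell2 g x))"

instance
proof
  fix f g h :: "'a ell2" and r :: real
  show "inner f g = inner g f"
    unfolding inner_ell2_def
    by (subst complex_cnj_cnj[of "infsum _ _", symmetric], subst infsum_cnj[symmetric])
      (simp add: mult.commute)
  show "inner (f + g) h = inner f h + inner g h"
    by (simp add: inner_ell2_def plus_ell2.rep_eq ring_distribs infsum_add ell2_inner_summable Rep_ell2)
  show "inner (r *\<^sub>R f) g = r * inner f g"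
    by (simp add: inner_ell2_def scaleR_ell2.rep_eq infsum_scaleR_right)
  have *: "inner f f = (\<Sum>\<^sub>\<infinity>x. (norm (Rep_ell2 f x))\<^sup>2)" for f :: "'a ell2"
    using infsum_Re[OF ell2_inner_summable[OF Rep_ell2[of f] Rep_ell2[of f]]]
    by (simp add: inner_ell2_def complex_mult_cnj cmod_power2)
  show "0 \<le> inner f f" unfolding * by (simp add: infsum_nonneg)
  show n: "norm f = sqrt (inner f f)" for f :: "'a ell2"
    unfolding * norm_ell2.rep_eq by (rule lp2_norm)
  show "inner f f = 0 \<longleftrightarrow> f = 0"
    using n[of f] norm_eq_zero[of f] by simp
qed

end

text \<open>Both sides are iterated sums of one double family, which is absolutely summable because
  products of values of u and v are bounded by sums of squares and f is in l^1(G).\<close>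

lemma lreg_adjoint:
  assumes f: "f \<in> lp 1" and sf: "star f \<in> lp 1"
  shows "inner (lreg (star f) g) h = inner g (lreg f h)"
proof -
  define u v where "u = Rep_ell2 g" and "v = Rep_ell2 h"
  have u: "(\<lambda>x. (norm (u x))\<^sup>2) summable_on UNIV" and v: "(\<lambda>x. (norm (v x))\<^sup>2) summable_on UNIV"
    using Rep_ell2[of g] Rep_ell2[of h] by (auto simp: u_def v_def lp2_iff)
  define S where "S = (\<Sum>\<^sub>\<infinity>x. (norm (u x))\<^sup>2) + (\<Sum>\<^sub>\<infinity>x. (norm (v x))\<^sup>2)"
  define F where "F = (\<lambda>y x. cnj (f y) * u x * cnj (v (- y + x)))"
  have "(\<lambda>(y, x). norm (f y) * ((norm (u x))\<^sup>2 + (norm (v (- y + x)))\<^sup>2)) summable_on UNIV \<times> UNIV"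
  proof (rule summable_on_SigmaI)
    have "((\<lambda>x. (norm (v (- y + x)))\<^sup>2) has_sum (\<Sum>\<^sub>\<infinity>x. (norm (v x))\<^sup>2)) UNIV" for y
      using has_sum_infsum[OF v] has_sum_reindex_bij_betw[OF bij_add_left[of "- y"], of "\<lambda>x. (norm (v x))\<^sup>2"]
      by auto
    then show "((\<lambda>x. case (y, x) of (y, x) \<Rightarrow> norm (f y) * ((norm (u x))\<^sup>2 + (norm (v (- y + x)))\<^sup>2))
        has_sum (norm (f y) * S)) UNIV" for y
      using has_sum_infsum[OF u] by (auto intro!: has_sum_cmult_right has_sum_add simp: S_def)
    show "(\<lambda>y. norm (f y) * S) summable_on UNIV"
      using f by (intro summable_on_cmult_left) (simp add: lp1_iff)
  qed auto
  then have "(\<lambda>(y, x). F y x) summable_on UNIV \<times> UNIV"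
  proof (rule abs_summable_summable[OF Infinite_Sum.abs_summable_on_comparison_test'])
    have "norm a * norm b \<le> (norm a)\<^sup>2 + (norm b)\<^sup>2" for a b :: complex
      using sum_squares_bound[of "norm a" "norm b"]
        mult_nonneg_nonneg[OF norm_ge_zero[of a] norm_ge_zero[of b]] by linarith
    then show "norm (case yx of (y, x) \<Rightarrow> F y x)
        \<le> (case yx of (y, x) \<Rightarrow> norm (f y) * ((norm (u x))\<^sup>2 + (norm (v (- y + x)))\<^sup>2))" for yx
      by (auto simp: F_def norm_mult mult.assoc intro!: mult_left_mono split: prod.split)
  qed
  then have sw: "(\<Sum>\<^sub>\<infinity>y. \<Sum>\<^sub>\<infinity>x. F y x) = (\<Sum>\<^sub>\<infinity>x. \<Sum>\<^sub>\<infinity>y. F y x)"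
    and sF: "(\<lambda>(y, x). F y x) summable_on UNIV \<times> UNIV"
    by (auto intro: infsum_swap_banach)
  have "inner g (lreg f h) = Re (\<Sum>\<^sub>\<infinity>x. \<Sum>\<^sub>\<infinity>y. F y x)"
    by (simp add: inner_ell2_def Rep_lreg[OF f] conv_def F_def u_def v_def infsum_cnj[symmetric]
        infsum_cmult_right'[symmetric] mult_ac)
  moreover have "inner (lreg (star f) g) h = Re (\<Sum>\<^sub>\<infinity>y. \<Sum>\<^sub>\<infinity>x. F y x)"
  proof -
    \<comment> \<open>\<open>G\<close> is \<open>F\<close> after the substitution of
      \<open>y + x\<close> for \<open>x\<close>. In this form the inner sum over y is the
      convolution by \<open>star f\<close>; the order of summation is exchanged once for
      \<open>F\<close> and once for \<open>G\<close>.\<close>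
    define G where "G = (\<lambda>y x. cnj (f y) * u (y + x) * cnj (v x))"
    have "(\<lambda>(y, x). F y x) summable_on UNIV \<times> UNIV \<longleftrightarrow> (\<lambda>(y, x). G y x) summable_on UNIV \<times> UNIV"
      by (rule summable_on_reindex_bij_witness[where i = "\<lambda>(y, x). (y, y + x)" and j = "\<lambda>(y, x). (y, - y + x)"])
        (auto simp: F_def G_def add.assoc[symmetric])
    then have "(\<Sum>\<^sub>\<infinity>y. \<Sum>\<^sub>\<infinity>x. G y x) = (\<Sum>\<^sub>\<infinity>x. \<Sum>\<^sub>\<infinity>y. G y x)"
      using sF by (intro infsum_swap_banach) simp
    moreover have "(\<Sum>\<^sub>\<infinity>x. F y x) = (\<Sum>\<^sub>\<infinity>x. G y x)" for y
      using infsum_reindex_bij_betw[OF bij_add_left[of y], of "F y"]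
      by (simp add: F_def G_def add.assoc[symmetric])
    moreover have "conv (star f) u x * cnj (v x) = (\<Sum>\<^sub>\<infinity>y. G y x)" for x
      using infsum_reindex_bij_betw[OF bij_uminus_group, of "\<lambda>y. cnj (f y) * u (y + x)"]
      by (simp add: conv_def star_def G_def infsum_cmult_left')
    ultimately show ?thesis
      by (simp add: inner_ell2_def Rep_lreg[OF sf] flip: u_def v_def)
  qed
  ultimately show ?thesis using sw by simp
qed

text \<open>Expanding \<bar>x - RSx/M\<bar>^2 gives \<bar>x\<bar>^2 - 2\<bar>Sx\<bar>^2/M +
  \<bar>RSx\<bar>^2/M^2. The last term is at most \<bar>Sx\<bar>^2/M, and the left inverse
  \<open>T\<close> bounds \<bar>Sx\<bar> below by \<bar>x\<bar>/\<bar>T\<bar>. With t =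
  1/(M\<bar>T\<bar>^2) this leaves (1 - t)\<bar>x\<bar>^2, and 1 - t \<le> (1 - t/2)^2 removes the
  square root.\<close>

lemma norm_id_minus_adjoint_comp_le:
  fixes S R T :: "'a::real_inner \<Rightarrow>\<^sub>L 'a"
  assumes adj: "\<And>x y. inner (R x) y = inner x (S y)"
    and M: "0 < M" "(norm R)\<^sup>2 \<le> M" and T: "T o\<^sub>L S = id_blinfun" and MT: "1 \<le> M * (norm T)\<^sup>2"
  shows "norm (id_blinfun - (1 / M) *\<^sub>R (R o\<^sub>L S)) \<le> 1 - 1 / (2 * (M * (norm T)\<^sup>2))"
proof (rule norm_blinfun_bound)
  define t where "t = 1 / (M * (norm T)\<^sup>2)"
  have t: "0 \<le> t" "t \<le> 1" and t2: "1 - 1 / (2 * (M * (norm T)\<^sup>2)) = 1 - t / 2"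
    using MT M by (auto simp: t_def divide_simps)
  show "0 \<le> 1 - 1 / (2 * (M * (norm T)\<^sup>2))" using t t2 by simp
  fix x
  have T0: "0 < norm T" using MT by (cases "norm T = 0") auto
  have "norm x = norm (T (S x))" using T by (metis blinfun_apply_id_blinfun blinfun_apply_blinfun_compose id_apply)
  then have "norm x \<le> norm T * norm (S x)" using norm_blinfun by metis
  then have "(norm x)\<^sup>2 \<le> (norm T)\<^sup>2 * (norm (S x))\<^sup>2"
    using power_mono[of "norm x" "norm T * norm (S x)" 2] by (simp add: power_mult_distrib)
  then have 1: "t * (norm x)\<^sup>2 \<le> (norm (S x))\<^sup>2 / M"
    using T0 M by (simp add: t_def field_simps)
  have "norm (R (S x)) \<le> norm R * norm (S x)" by (rule norm_blinfun)
  then have "(norm (R (S x)))\<^sup>2 \<le> (norm R)\<^sup>2 * (norm (S x))\<^sup>2"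
    using power_mono[of "norm (R (S x))" "norm R * norm (S x)" 2] by (simp add: power_mult_distrib)
  also have "\<dots> \<le> M * (norm (S x))\<^sup>2" using M by (intro mult_right_mono) auto
  finally have 2: "(norm (R (S x)))\<^sup>2 / M\<^sup>2 \<le> (norm (S x))\<^sup>2 / M"
    using M by (simp add: field_simps power2_eq_square)
  have e: "(norm (x - c *\<^sub>R y))\<^sup>2 = (norm x)\<^sup>2 - 2 * (c * inner y x) + c\<^sup>2 * (norm y)\<^sup>2" for c y
    unfolding power2_norm_eq_inner
    unfolding inner_diff_left inner_diff_right inner_scaleR_left inner_scaleR_right
      inner_commute[of x y] power2_eq_square by (simp add: algebra_simps)
  have ip: "inner (R (S x)) x = (norm (S x))\<^sup>2" by (simp add: adj power2_norm_eq_inner)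
  have "(norm (x - (1 / M) *\<^sub>R R (S x)))\<^sup>2
      = (norm x)\<^sup>2 - 2 * ((norm (S x))\<^sup>2 / M) + (norm (R (S x)))\<^sup>2 / M\<^sup>2"
    using e[of "1 / M" "R (S x)"] unfolding ip power_one_over by simp
  also have "\<dots> \<le> (1 - t) * (norm x)\<^sup>2" using 1 2 unfolding left_diff_distrib mult_1_left by linarith
  also have "\<dots> \<le> (1 - t / 2)\<^sup>2 * (norm x)\<^sup>2"
    by (intro mult_right_mono) (auto simp: power2_eq_square algebra_simps)
  finally have "(norm (x - (1 / M) *\<^sub>R R (S x)))\<^sup>2 \<le> ((1 - t / 2) * norm x)\<^sup>2"
    by (simp add: power_mult_distrib)
  then have "norm (x - (1 / M) *\<^sub>R R (S x)) \<le> (1 - t / 2) * norm x"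
    by (rule power2_le_imp_le) (use t in simp)
  then show "norm ((id_blinfun - (1 / M) *\<^sub>R (R o\<^sub>L S)) x) \<le> (1 - 1 / (2 * (M * (norm T)\<^sup>2))) * norm x"
    unfolding t2 by (simp add: blinfun.diff_left blinfun.scaleR_left)
qed

section \<open>Neumann series bounds and interpolation\<close>

text \<open>The product of the two powers is the exponential of 2^k (ln \<rho> + (\<gamma>/2)^k ln
  P). Since \<gamma> < 2 the bracket tends to ln \<rho> < 0, so a large \<open>P\<close> is
  eventually outweighed.\<close>

lemma eventually_super_geometric_small:
  fixes \<rho> \<gamma> P Q \<epsilon> :: real
  assumes "0 < \<rho>" "\<rho> < 1" "0 < \<gamma>" "\<gamma> < 2" "0 < P" "0 < Q" "0 < \<epsilon>"
  obtains k :: nat where "\<rho> powr (2 ^ k) * P powr (\<gamma> ^ k) * Q \<le> \<epsilon>"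
proof -
  have "(\<lambda>k. ln \<rho> + (\<gamma> / 2) ^ k * ln P) \<longlonglongrightarrow> ln \<rho> + 0 * ln P"
    using assms by (intro tendsto_intros LIMSEQ_power_zero) auto
  moreover have "filterlim (\<lambda>k. (2::real) ^ k) at_top sequentially"
    by (rule filterlim_at_infinity_imp_filterlim_at_top[OF filterlim_realpow_sequentially_gt1]) auto
  ultimately have "filterlim (\<lambda>k. (ln \<rho> + (\<gamma> / 2) ^ k * ln P) * 2 ^ k) at_bot sequentially"
    using assms by (intro filterlim_tendsto_neg_mult_at_bot[where c = "ln \<rho>"]) auto
  then have "((\<lambda>k. exp ((ln \<rho> + (\<gamma> / 2) ^ k * ln P) * 2 ^ k) * Q) \<longlonglongrightarrow> 0 * Q)"
    by (intro tendsto_intros filterlim_compose[OF exp_at_bot])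
  then have "eventually (\<lambda>k. exp ((ln \<rho> + (\<gamma> / 2) ^ k * ln P) * 2 ^ k) * Q < \<epsilon>) sequentially"
    using assms(7) by (intro order_tendstoD) auto
  then obtain k where k: "exp ((ln \<rho> + (\<gamma> / 2) ^ k * ln P) * 2 ^ k) * Q < \<epsilon>"
    by (auto simp: eventually_sequentially)
  have "\<rho> powr (2 ^ k) * P powr (\<gamma> ^ k) = exp ((ln \<rho> + (\<gamma> / 2) ^ k * ln P) * 2 ^ k)"
    using assms by (simp add: powr_def exp_add[symmetric] power_divide ring_distribs mult_ac)
  then show ?thesis using k that[of k] by simp
qed

text \<open>
  Iterating the doubling inequality gives \<open>\<nu> (2\<^sup>k) \<le> Q P\<^bsup>(2 - \<theta>)\<^sup>k\<^esup> \<rho>\<^bsup>2\<^sup>k\<^esup>\<close>, which tends to zero since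
  \<open>2 - \<theta> < 2\<close>. Hence some block length \<open>2\<^sup>k\<close>, depending on the constants only, halves \<open>\<nu>\<close>.
\<close>

lemma partial_sums_uniformly_bounded:
  fixes K A B \<theta> \<rho> :: real
  assumes K: "0 < K" and A: "0 < A" and B: "0 \<le> B" and \<theta>: "0 < \<theta>" "\<theta> < 1" and \<rho>: "0 < \<rho>" "\<rho> < 1"
  obtains H where "0 \<le> H" and
    "\<And>\<nu> n. \<lbrakk>\<And>n. 0 \<le> \<nu> n; \<nu> 0 \<le> B; \<nu> 1 \<le> B; \<And>m n. \<nu> (m + n) \<le> K * \<nu> m * \<nu> n;
      \<And>n. \<nu> (2 * n) \<le> A * \<nu> n powr (2 - \<theta>) * \<rho> powr (real n * \<theta>)\<rbrakk> \<Longrightarrow> (\<Sum>i<n. \<nu> i) \<le> H"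
proof -
  \<comment> \<open>\<open>Q\<close> is the positive solution of A Q^\<gamma> = Q, which turns the
    doubling inequality into an exact recursion for the majorant \<open>E\<close>. \<open>P\<close>
    is chosen to make \<open>E 0 = B + 1\<close>; the added 1 keeps \<open>P\<close> positive when
    \<open>B\<close> is 0.\<close>
  define \<gamma> Q P where "\<gamma> = 2 - \<theta>" and "Q = A powr (- 1 / (1 - \<theta>))" and "P = (B + 1) / (\<rho> * Q)"
  define E where "E = (\<lambda>k::nat. \<rho> powr (2 ^ k) * P powr (\<gamma> ^ k) * Q)"
  have \<gamma>: "0 < \<gamma>" "\<gamma> < 2" using \<theta> by (auto simp: \<gamma>_def)
  have Q: "0 < Q" using A by (simp add: Q_def)
  have P: "0 < P" using B Q \<rho> by (simp add: P_def)
  have E0: "E 0 = B + 1" using P Q \<rho> B by (simp add: E_def P_def)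
  have AQ: "A * Q powr \<gamma> = Q"
  proof -
    have "Q powr \<gamma> = Q powr (1 - \<theta>) * Q powr 1" by (simp only: powr_add[symmetric]) (simp add: \<gamma>_def)
    moreover have "Q powr (1 - \<theta>) = A powr (- 1)" using \<theta> by (simp add: Q_def powr_powr)
    ultimately show ?thesis using A Q by (simp add: powr_minus)
  qed
  have ES: "A * E k powr \<gamma> * \<rho> powr (real (2 ^ k) * \<theta>) = E (Suc k)" for k
  proof -
    have "E k powr \<gamma> = \<rho> powr (2 ^ k * \<gamma>) * P powr (\<gamma> ^ Suc k) * Q powr \<gamma>"
      using \<rho> P Q by (simp add: E_def powr_mult powr_powr mult.commute)
    moreover have "\<rho> powr (2 ^ k * \<gamma>) * \<rho> powr (real (2 ^ k) * \<theta>) = \<rho> powr (2 ^ Suc k)"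
      by (simp add: powr_add[symmetric] \<gamma>_def algebra_simps)
    ultimately have "A * E k powr \<gamma> * \<rho> powr (real (2 ^ k) * \<theta>)
        = \<rho> powr (2 ^ Suc k) * P powr (\<gamma> ^ Suc k) * (A * Q powr \<gamma>)"
      by (metis (no_types, opaque_lifting) mult.assoc mult.commute)
    then show ?thesis by (simp add: AQ E_def)
  qed
  obtain k where k: "E k \<le> 1 / (2 * K)"
    using eventually_super_geometric_small[of \<rho> \<gamma> P Q "1 / (2 * K)"] \<rho> \<gamma> P Q K by (auto simp: E_def)
  define H where "H = 2 * (\<Sum>i<2 ^ k. B * (K * B) ^ i)"
  show ?thesis
  proof (rule that[of H])
    show "0 \<le> H" using B K by (auto simp: H_def intro!: sum_nonneg)
    fix \<nu> :: "nat \<Rightarrow> real" and n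
    assume \<nu>: "\<And>n. 0 \<le> \<nu> n" and \<nu>0: "\<nu> 0 \<le> B" and \<nu>1: "\<nu> 1 \<le> B"
      and \<nu>add: "\<And>m n. \<nu> (m + n) \<le> K * \<nu> m * \<nu> n"
      and \<nu>dbl: "\<And>n. \<nu> (2 * n) \<le> A * \<nu> n powr (2 - \<theta>) * \<rho> powr (real n * \<theta>)"
    have "\<nu> (2 ^ j) \<le> E j" for j
    proof (induction j)
      case 0 then show ?case using \<nu>1 E0 by simp
    next
      case (Suc j)
      have "\<nu> (2 ^ Suc j) \<le> A * \<nu> (2 ^ j) powr \<gamma> * \<rho> powr (real (2 ^ j) * \<theta>)"
        using \<nu>dbl[of "2 ^ j"] by (simp add: \<gamma>_def)
      also have "\<dots> \<le> A * E j powr \<gamma> * \<rho> powr (real (2 ^ j) * \<theta>)"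
        using A \<gamma> \<nu> Suc by (intro mult_right_mono mult_left_mono powr_mono2) auto
      finally show ?case by (simp only: ES)
    qed
    then have \<nu>k: "K * \<nu> (2 ^ k) \<le> 1 / 2"
      using k K order_trans[of "\<nu> (2 ^ k)" "E k" "1 / (2 * K)"] by (simp add: field_simps)
    have half: "\<nu> (i + 2 ^ k) \<le> \<nu> i / 2" for i
    proof -
      have "\<nu> (i + 2 ^ k) \<le> \<nu> i * (K * \<nu> (2 ^ k))" using \<nu>add[of i "2 ^ k"] by (simp add: mult_ac)
      also have "\<dots> \<le> \<nu> i * (1 / 2)" using \<nu>k \<nu> by (intro mult_left_mono) auto
      finally show ?thesis by simp
    qed
    have bd: "\<nu> i \<le> B * (K * B) ^ i" for i
    proof (induction i)
      case 0 then show ?case using \<nu>0 by simp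
    next
      case (Suc i)
      have "\<nu> (Suc i) \<le> K * \<nu> i * \<nu> 1" using \<nu>add[of i 1] by simp
      also have "\<dots> \<le> K * (B * (K * B) ^ i) * B"
        using Suc \<nu>1 K B \<nu> by (intro mult_mono mult_left_mono) auto
      finally show ?case by (simp add: mult_ac)
    qed
    \<comment> \<open>Shifting the index by the block length bounds the sum by the first block plus
      half of the sum itself. Solving for the sum doubles the block, which is the factor 2 in
      \<open>H\<close>.\<close>
    have "(\<Sum>i<n. \<nu> i) \<le> (\<Sum>i<2 ^ k + n. \<nu> i)"
      using \<nu> by (intro sum_mono2) auto
    also have "\<dots> = (\<Sum>i<2 ^ k. \<nu> i) + (\<Sum>i<n. \<nu> (i + 2 ^ k))"
      by (simp add: lessThan_atLeast0 sum.shift_bounds_nat_ivl[of \<nu> 0 "2 ^ k" n, simplified, symmetric]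
          sum.atLeastLessThan_concat add.commute)
    also have "\<dots> \<le> H / 2 + (\<Sum>i<n. \<nu> i / 2)"
      unfolding H_def using bd half by (intro add_mono) (auto intro!: sum_mono)
    finally show "(\<Sum>i<n. \<nu> i) \<le> H" by (simp add: sum_divide_distrib[symmetric])
  qed
qed

section \<open>Interpolation between the sup norm and the weighted l^p norm\<close>

lemma weight_ge_1:
  assumes "weight \<omega>"
  shows "1 \<le> \<omega> x"
proof (rule ccontr)
  assume "\<not> 1 \<le> \<omega> x"
  \<comment> \<open>Submultiplicativity at x and its inverse, with the symmetry of \<omega>.\<close>
  moreover have "\<omega> 0 \<le> \<omega> x * \<omega> x" using assms unfolding weight_def by (metis add.right_inverse)
  moreover have "0 \<le> \<omega> x" "\<omega> 0 = 1" using assms by (auto simp: weight_def)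
  ultimately show False using mult_left_le[of "\<omega> x" "\<omega> x"] by simp
qed

text \<open>
  Writing \<open>\<bar>f\<bar> \<omega> u = \<bar>f\<bar>\<^sup>\<theta> (\<bar>f\<bar> \<omega>)\<^bsup>1 - \<theta>\<^esup> (\<omega>\<^sup>\<theta> u)\<close>, Young's inequality applies with exponents \<open>p / (1 - \<theta>)\<close> and
  \<open>t\<close>, where \<open>1 / t = 1 - (1 - \<theta>) / p\<close>. For small \<open>\<theta>\<close> one has \<open>t \<ge> s\<close> and \<open>\<theta> \<le> r / s\<close>, so that
  \<open>(\<omega>\<^sup>\<theta> u)\<^sup>t \<le> (u\<^sup>s \<omega>\<^sup>r)\<^bsup>t / s\<^esup>\<close> is summable.
\<close>

lemma weighted_l1_interpolation:
  fixes \<omega> u :: "'a \<Rightarrow> real"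
  assumes \<omega>: "\<And>x. 1 \<le> \<omega> x" and u: "\<And>x. 0 \<le> u x" and p: "1 \<le> p"
    and s: "0 < s" "1 - 1 / p < 1 / s" and r: "0 < r"
    and sm: "(\<lambda>x. u x powr s * \<omega> x powr r) summable_on UNIV"
  obtains C \<theta> where "0 < C" "0 < \<theta>" "\<theta> < 1"
    "\<And>f m. \<lbrakk>f \<in> lpw p \<omega>; \<And>x. norm (f x) \<le> m\<rbrakk> \<Longrightarrow> (\<lambda>x. norm (f x) * (\<omega> x * u x)) summable_on UNIV \<and>
      (\<Sum>\<^sub>\<infinity>x. norm (f x) * (\<omega> x * u x)) \<le> C * m powr \<theta> * lpw_norm p \<omega> f powr (1 - \<theta>)"
proof -
  \<comment> \<open>The second entry is the value of \<theta> for which \<open>t\<close> equals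
    \<open>s\<close>; it is positive because \<open>s\<close> lies below the conjugate exponent of
    \<open>p\<close>. The entry 1/2 keeps \<theta> below 1.\<close>
  define \<theta> where "\<theta> = min (min (r / s) (p * (1 / s - (1 - 1 / p)))) (1 / 2)"
  have \<theta>: "0 < \<theta>" "\<theta> < 1" "\<theta> \<le> r / s" "\<theta> \<le> p * (1 / s - (1 - 1 / p))"
    using p s r by (auto simp: \<theta>_def)
  define t P where "t = 1 / (1 - (1 - \<theta>) / p)" and "P = p / (1 - \<theta>)"
  have it: "0 < 1 - (1 - \<theta>) / p" "1 - (1 - \<theta>) / p < 1" "1 - (1 - \<theta>) / p \<le> 1 / s"
  proof -
    show "0 < 1 - (1 - \<theta>) / p" "1 - (1 - \<theta>) / p < 1" using \<theta> p by (auto simp: field_simps)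
    have "\<theta> / p \<le> 1 / s - (1 - 1 / p)" using \<theta>(4) p by (simp add: pos_divide_le_eq mult.commute)
    then show "1 - (1 - \<theta>) / p \<le> 1 / s" by (simp add: diff_divide_distrib)
  qed
  have t: "1 < t" "s \<le> t" using it s by (auto simp: t_def field_simps)
  have P: "1 < P" using \<theta> p by (simp add: P_def field_simps)
  have Pt: "1 / P + 1 / t = 1" using \<theta> p by (simp add: P_def t_def)
  define v Z where "v = (\<lambda>x. u x powr s * \<omega> x powr r)" and "Z = infsum v UNIV"
  have v: "0 \<le> v x" "v x \<le> Z" for x
    using sm finite_sum_le_infsum[of v UNIV "{x}"] by (auto simp: v_def Z_def)
  define b where "b = (\<lambda>x. \<omega> x powr \<theta> * u x)"
  have b: "0 \<le> b x" for x using u by (simp add: b_def)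
  have bt: "b x powr t \<le> Z powr (t / s - 1) * v x" for x
  proof (cases "v x = 0")
    case True
    then have "u x = 0" using \<omega>[of x] by (auto simp: v_def)
    then show ?thesis using v by (simp add: b_def)
  next
    case False
    have "b x powr t = \<omega> x powr (\<theta> * t) * u x powr t" using \<omega>[of x] u by (simp add: b_def powr_mult powr_powr)
    also have "\<dots> \<le> \<omega> x powr (r * (t / s)) * u x powr t"
      using \<omega>[of x] \<theta> t s mult_right_mono[OF \<theta>(3), of t] by (intro mult_right_mono powr_mono) auto
    also have "\<dots> = v x powr (t / s)" using s by (simp add: v_def powr_mult powr_powr)
    also have "\<dots> = v x powr (t / s - 1) * v x powr 1" by (simp only: powr_add[symmetric]) simp
    \<comment> \<open>Each summand is at most the total \<open>Z\<close>, so raising the exponent of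
      \<open>v x\<close> from 1 to \<open>t / s\<close> costs only a constant.\<close>
    also have "\<dots> \<le> Z powr (t / s - 1) * v x"
      using v[of x] False t s by (auto intro!: mult_right_mono powr_mono2)
    finally show ?thesis .
  qed
  have bts: "(\<lambda>x. b x powr t) summable_on UNIV"
  proof (rule summable_on_comparison_test)
    show "(\<lambda>x. Z powr (t / s - 1) * v x) summable_on UNIV"
      using sm by (intro summable_on_cmult_right) (simp add: v_def)
  qed (use bt in auto)
  \<comment> \<open>The summand 1 is the total mass of (\<bar>f\<bar> \<omega>)^p / N^p, the other
    is the mass of b^t: the two sides of Young's inequality summed over G.\<close>
  define C where "C = 1 + (\<Sum>\<^sub>\<infinity>x. b x powr t)"
  have C: "0 < C" by (simp add: C_def add_pos_nonneg infsum_nonneg)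
  show ?thesis
  proof (rule that[OF C \<theta>(1,2)])
    fix f :: "'a \<Rightarrow> complex" and m
    assume f: "f \<in> lpw p \<omega>" and m: "\<And>x. norm (f x) \<le> m"
    have f': "(\<lambda>x. f x * complex_of_real (\<omega> x)) \<in> lp p" using f by (simp add: lpw_def)
    have fw: "norm (f x * complex_of_real (\<omega> x)) = norm (f x) * \<omega> x" for x
      using \<omega>[of x] by (simp add: norm_mult)
    define N where "N = lpw_norm p \<omega> f"
    have N0: "0 \<le> N" by (simp add: N_def lpw_norm_def lp_norm_nonneg)
    have p0: "0 < p" using p by simp
    have m0: "0 \<le> m" using m norm_ge_zero order_trans by blast
    show "(\<lambda>x. norm (f x) * (\<omega> x * u x)) summable_on UNIV \<and>
      (\<Sum>\<^sub>\<infinity>x. norm (f x) * (\<omega> x * u x)) \<le> C * m powr \<theta> * lpw_norm p \<omega> f powr (1 - \<theta>)"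
    proof (cases "N = 0")
      case True
      then have "f x = 0" for x
        using lp_norm_eq_0[OF p0 f'] \<omega>[of x] by (auto simp: N_def lpw_norm_def fun_eq_iff)
      then show ?thesis using C by (simp add: lpw_norm_def)
    next
      case False
      then have N: "0 < N" using N0 by simp
      have Np: "(\<lambda>x. (norm (f x) * \<omega> x) powr p) summable_on UNIV"
          "(\<Sum>\<^sub>\<infinity>x. (norm (f x) * \<omega> x) powr p) = N powr p"
        using f' lp_norm_powr[OF p0, of "\<lambda>x. f x * complex_of_real (\<omega> x)"]
        by (auto simp: lp_def fw N_def lpw_norm_def)
      define M where "M = m powr \<theta> * N powr (1 - \<theta>)"
      have pt: "norm (f x) * (\<omega> x * u x) \<le> M * ((norm (f x) * \<omega> x) powr p / N powr p + b x powr t)" for x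
      proof -
        \<comment> \<open>Dividing by \<open>N\<close> makes the powers \<open>a powr P\<close> sum
          to 1. The additive form of Young's inequality thus yields a product estimate, with
          \<open>N powr (1 - \<theta>)\<close> restored as a factor.\<close>
        define a where "a = (norm (f x) * \<omega> x / N) powr (1 - \<theta>)"
        have aP: "a powr P = (norm (f x) * \<omega> x) powr p / N powr p"
          using \<theta> N \<omega>[of x] by (simp add: a_def powr_powr P_def powr_divide)
        have "a * b x \<le> a powr P / P + b x powr t / t"
          using Youngs_inequality[OF P t(1) Pt, of a "b x"] b by (simp add: a_def)
        also have "\<dots> \<le> a powr P + b x powr t"
          using P t by (intro add_mono) (auto simp: divide_le_eq mult_le_cancel_left1)
        finally have ab: "a * b x \<le> (norm (f x) * \<omega> x) powr p / N powr p + b x powr t" by (simp add: aP)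
        have e: "y powr \<theta> * y powr (1 - \<theta>) = y" if "0 \<le> y" for y :: real
          using that by (simp only: powr_add[symmetric]) simp
        have "N powr (1 - \<theta>) * a = norm (f x) powr (1 - \<theta>) * \<omega> x powr (1 - \<theta>)"
          using N \<omega>[of x] by (simp add: a_def powr_divide powr_mult)
        then have "norm (f x) powr \<theta> * N powr (1 - \<theta>) * (a * b x) =
           (norm (f x) powr \<theta> * norm (f x) powr (1 - \<theta>)) * (\<omega> x powr \<theta> * \<omega> x powr (1 - \<theta>)) * u x"
          by (simp add: b_def mult_ac)
        also have "\<dots> = norm (f x) * (\<omega> x * u x)" using e[of "norm (f x)"] e[of "\<omega> x"] \<omega>[of x] by simp
        finally have "norm (f x) * (\<omega> x * u x) = norm (f x) powr \<theta> * N powr (1 - \<theta>) * (a * b x)" ..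
        also have "\<dots> \<le> M * (a * b x)"
          unfolding M_def using \<theta> m b by (intro mult_right_mono powr_mono2) (auto simp: a_def)
        also have "\<dots> \<le> M * ((norm (f x) * \<omega> x) powr p / N powr p + b x powr t)"
          using ab by (intro mult_left_mono) (auto simp: M_def)
        finally show ?thesis .
      qed
      have "(\<lambda>x. (norm (f x) * \<omega> x) powr p / N powr p) summable_on UNIV"
        using summable_on_cmult_left[OF Np(1), of "inverse (N powr p)"] by (simp add: divide_inverse)
      then have rs: "(\<lambda>x. M * ((norm (f x) * \<omega> x) powr p / N powr p + b x powr t)) summable_on UNIV"
        and ri: "(\<Sum>\<^sub>\<infinity>x. M * ((norm (f x) * \<omega> x) powr p / N powr p + b x powr t)) = M * C"
        using bts N infsum_cmult_left'[of "\<lambda>x. (norm (f x) * \<omega> x) powr p" "inverse (N powr p)" UNIV]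
        by (auto simp: infsum_cmult_right' infsum_add C_def Np(2) divide_inverse
            intro!: summable_on_cmult_right summable_on_add)
      have ls: "(\<lambda>x. norm (f x) * (\<omega> x * u x)) summable_on UNIV"
        by (rule summable_on_comparison_test[OF rs])
          (use pt u order_trans[OF zero_le_one \<omega>] in auto)
      with infsum_mono[OF ls rs pt] show ?thesis
        unfolding ri by (simp add: M_def N_def mult_ac)
    qed
  qed
qed

section \<open>The Banach \<open>*\<close>-algebra \<open>\<ell>\<^sup>p(G, \<omega>)\<close>\<close>

lemma lpw_norm_nonneg: "0 \<le> lpw_norm p \<omega> f"
  by (simp add: lpw_norm_def lp_norm_nonneg)

lemma lpw_add:
  assumes "1 \<le> p" "f \<in> lpw p \<omega>" "g \<in> lpw p \<omega>"
  shows "(\<lambda>x. f x + g x) \<in> lpw p \<omega>" "lpw_norm p \<omega> (\<lambda>x. f x + g x) \<le> lpw_norm p \<omega> f + lpw_norm p \<omega> g"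
  using lp_triangle[OF assms(1), of "\<lambda>x. f x * complex_of_real (\<omega> x)" "\<lambda>x. g x * complex_of_real (\<omega> x)"] assms
  by (auto simp: lpw_def lpw_norm_def ring_distribs)

lemma lpw_scale:
  assumes "1 \<le> p" "f \<in> lpw p \<omega>"
  shows "(\<lambda>x. a * f x) \<in> lpw p \<omega>" "lpw_norm p \<omega> (\<lambda>x. a * f x) = norm a * lpw_norm p \<omega> f"
  using lp_scale[of p "\<lambda>x. f x * complex_of_real (\<omega> x)" a] assms
  by (auto simp: lpw_def lpw_norm_def mult.assoc)

lemma lpw_diff:
  assumes "1 \<le> p" "f \<in> lpw p \<omega>" "g \<in> lpw p \<omega>"
  shows "(\<lambda>x. f x - g x) \<in> lpw p \<omega>"
  using lpw_add(1)[OF assms(1,2) lpw_scale(1)[OF assms(1,3), of "- 1"]] by simp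

lemma norm_le_lpw_norm:
  assumes "1 \<le> p" "1 \<le> \<omega> x" "f \<in> lpw p \<omega>"
  shows "norm (f x) \<le> lpw_norm p \<omega> f"
proof -
  have "norm (f x) * 1 \<le> norm (f x) * \<omega> x" using assms(2) by (intro mult_left_mono) auto
  also have "\<dots> \<le> lpw_norm p \<omega> f"
    using norm_le_lp_norm[of p "\<lambda>x. f x * complex_of_real (\<omega> x)" x] assms
    by (simp add: lpw_def lpw_norm_def norm_mult)
  finally show ?thesis by simp
qed

text \<open>As \<omega> \<ge> 1, the norm dominates each value, so a Cauchy sequence converges
  pointwise. \<open>lp_fatou\<close> applied to F m - F n as n grows upgrades this to convergence in
  norm.\<close>

lemma lpw_complete:
  assumes \<omega>: "\<And>x. 1 \<le> \<omega> x" and p: "1 \<le> p" and F: "\<And>n::nat. F n \<in> lpw p \<omega>"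
    and C: "\<And>\<epsilon>. 0 < \<epsilon> \<Longrightarrow> \<exists>M. \<forall>m\<ge>M. \<forall>n\<ge>M. lpw_norm p \<omega> (\<lambda>x. F m x - F n x) < \<epsilon>"
  shows "\<exists>f\<in>lpw p \<omega>. (\<lambda>n. lpw_norm p \<omega> (\<lambda>x. F n x - f x)) \<longlonglongrightarrow> 0"
proof -
  have "Cauchy (\<lambda>n. F n x)" for x
  proof (rule CauchyI)
    fix \<epsilon> :: real assume "0 < \<epsilon>"
    then obtain M where M: "\<forall>m\<ge>M. \<forall>n\<ge>M. lpw_norm p \<omega> (\<lambda>x. F m x - F n x) < \<epsilon>" using C by blast
    have "norm (F m x - F n x) \<le> lpw_norm p \<omega> (\<lambda>x. F m x - F n x)" for m n
      by (rule norm_le_lpw_norm[OF p \<omega> lpw_diff[OF p F F]])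
    then show "\<exists>M. \<forall>m\<ge>M. \<forall>n\<ge>M. norm (F m x - F n x) < \<epsilon>" using M le_less_trans by blast
  qed
  then have "\<exists>l. (\<lambda>n. F n x) \<longlonglongrightarrow> l" for x by (simp add: Cauchy_convergent_iff convergent_def)
  then obtain f where f: "\<And>x. (\<lambda>n. F n x) \<longlonglongrightarrow> f x" by metis
  have lim: "(\<lambda>x. F m x - f x) \<in> lpw p \<omega> \<and> lpw_norm p \<omega> (\<lambda>x. F m x - f x) \<le> \<epsilon>"
    if \<epsilon>: "0 < \<epsilon>" and M: "\<forall>m\<ge>M. \<forall>n\<ge>M. lpw_norm p \<omega> (\<lambda>x. F m x - F n x) < \<epsilon>" and m: "M \<le> m" for \<epsilon> M m
    unfolding lpw_def lpw_norm_def mem_Collect_eq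
  proof (rule lp_fatou[where \<F> = sequentially])
    show "(\<lambda>n. (F m x - F n x) * complex_of_real (\<omega> x)) \<longlonglongrightarrow> (F m x - f x) * complex_of_real (\<omega> x)" for x
      by (intro tendsto_intros f)
    show "\<forall>\<^sub>F n in sequentially. (\<lambda>x. (F m x - F n x) * complex_of_real (\<omega> x)) \<in> lp p \<and>
        lp_norm p (\<lambda>x. (F m x - F n x) * complex_of_real (\<omega> x)) \<le> \<epsilon>"
      using eventually_ge_at_top[of M]
    proof eventually_elim
      case (elim n)
      then show ?case
        using M m lpw_diff[OF p F[of m] F[of n]] by (auto simp: lpw_def lpw_norm_def intro: less_imp_le)
    qed
  qed (use p \<epsilon> in auto)
  show ?thesis
  proof (rule bexI)
    obtain M where "\<forall>m\<ge>M. \<forall>n\<ge>M. lpw_norm p \<omega> (\<lambda>x. F m x - F n x) < 1" using C[of 1] by auto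
    then have "(\<lambda>x. F M x - f x) \<in> lpw p \<omega>" using lim[of 1 M M] by auto
    from lpw_diff[OF p F[of M] this] show "f \<in> lpw p \<omega>" by simp
    show "(\<lambda>n. lpw_norm p \<omega> (\<lambda>x. F n x - f x)) \<longlonglongrightarrow> 0"
    proof (rule LIMSEQ_I)
      fix \<epsilon> :: real assume "0 < \<epsilon>"
      then obtain M where "\<forall>m\<ge>M. \<forall>n\<ge>M. lpw_norm p \<omega> (\<lambda>x. F m x - F n x) < \<epsilon> / 2" using C[of "\<epsilon> / 2"] by auto
      then have "lpw_norm p \<omega> (\<lambda>x. F m x - f x) \<le> \<epsilon> / 2" if "M \<le> m" for m
        using lim[of "\<epsilon> / 2" M m] that \<open>0 < \<epsilon>\<close> by auto
      then have "norm (lpw_norm p \<omega> (\<lambda>x. F m x - f x) - 0) < \<epsilon>" if "M \<le> m" for m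
        using that \<open>0 < \<epsilon>\<close> lpw_norm_nonneg[of p \<omega> "\<lambda>x. F m x - f x"] by fastforce
      then show "\<exists>M. \<forall>n\<ge>M. norm (lpw_norm p \<omega> (\<lambda>x. F n x - f x) - 0) < \<epsilon>" by blast
    qed
  qed
qed

lemma lpw_banach_space:
  assumes \<omega>: "\<And>x. 1 \<le> \<omega> x" and p: "1 \<le> p"
  shows "banach_space_on (lpw p \<omega>) (lpw_norm p \<omega>)"
  unfolding banach_space_on_def
proof (intro conjI ballI allI impI)
  have p0: "0 < p" using p by simp
  show "(\<lambda>_. 0) \<in> lpw p \<omega>" by (simp add: lpw_def lp_zero[OF p0])
  fix f :: "'a \<Rightarrow> complex" and a assume f: "f \<in> lpw p \<omega>"
  show "0 \<le> lpw_norm p \<omega> f" by (rule lpw_norm_nonneg)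
  show "lpw_norm p \<omega> f = 0 \<longleftrightarrow> f = (\<lambda>_. 0)"
    using norm_le_lpw_norm[where \<omega> = \<omega>, OF p \<omega> f] by (auto simp: fun_eq_iff lpw_norm_def lp_zero[OF p0])
  show "(\<lambda>x. a * f x) \<in> lpw p \<omega>" "lpw_norm p \<omega> (\<lambda>x. a * f x) = cmod a * lpw_norm p \<omega> f"
    by (rule lpw_scale[OF p f])+
  fix g assume g: "g \<in> lpw p \<omega>"
  show "(\<lambda>x. f x + g x) \<in> lpw p \<omega>"
    "lpw_norm p \<omega> (\<lambda>x. f x + g x) \<le> lpw_norm p \<omega> f + lpw_norm p \<omega> g"
    by (rule lpw_add[OF p f g])+
next
  fix F :: "nat \<Rightarrow> 'a \<Rightarrow> complex"
  assume F: "\<forall>n. F n \<in> lpw p \<omega>"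
    and C: "\<forall>\<epsilon>>0. \<exists>M. \<forall>m\<ge>M. \<forall>n\<ge>M. lpw_norm p \<omega> (\<lambda>x. F m x - F n x) < \<epsilon>"
  show "\<exists>f\<in>lpw p \<omega>. (\<lambda>n. lpw_norm p \<omega> (\<lambda>x. F n x - f x)) \<longlonglongrightarrow> 0"
    by (rule lpw_complete[where \<omega> = \<omega>, OF \<omega> p F[rule_format] C[rule_format]])
qed

text \<open>Here \<open>submult\<close> is the quotient condition multiplied out and
  \<open>interpolation\<close> replaces the summability hypothesis. Fixing \<open>c\<close>,
  \<open>C\<close> and \<theta> ahead of all functions makes every later estimate uniform.\<close>

locale lpw_algebra =
  fixes \<omega> u :: "'a::group_add \<Rightarrow> real" and p c C \<theta> :: real
  assumes weight: "weight \<omega>" and p: "1 \<le> p" and u_nonneg: "\<And>x. 0 \<le> u x"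
    and c_pos: "0 < c" and c_le: "\<And>x. c \<le> \<omega> x * u x"
    and submult: "\<And>x y. \<omega> (x + y) \<le> \<omega> x * \<omega> y * (u x + u y)"
    and C_pos: "0 < C" and \<theta>: "0 < \<theta>" "\<theta> < 1"
    and interpolation: "\<And>f m. \<lbrakk>f \<in> lpw p \<omega>; \<And>x. norm (f x) \<le> m\<rbrakk> \<Longrightarrow>
      (\<lambda>x. norm (f x) * (\<omega> x * u x)) summable_on UNIV \<and>
      (\<Sum>\<^sub>\<infinity>x. norm (f x) * (\<omega> x * u x)) \<le> C * m powr \<theta> * lpw_norm p \<omega> f powr (1 - \<theta>)"
begin

abbreviation "A \<equiv> lpw p \<omega>"
abbreviation "N \<equiv> lpw_norm p \<omega>"

definition \<sigma>_norm :: "('a \<Rightarrow> complex) \<Rightarrow> real" where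
  "\<sigma>_norm f = (\<Sum>\<^sub>\<infinity>x. norm (f x) * (\<omega> x * u x))"

lemma p_pos: "0 < p" using p by simp

lemma weight_ge1: "1 \<le> \<omega> x" by (rule weight_ge_1[OF weight])

lemma norm_le_N: "f \<in> A \<Longrightarrow> norm (f x) \<le> N f"
  by (rule norm_le_lpw_norm[where \<omega> = \<omega>, OF p weight_ge1])

lemma \<sigma>_summable: "f \<in> A \<Longrightarrow> (\<lambda>x. norm (f x) * (\<omega> x * u x)) summable_on UNIV"
  using interpolation norm_le_N by blast

lemma \<sigma>_norm_le: "f \<in> A \<Longrightarrow> (\<And>x. norm (f x) \<le> m) \<Longrightarrow> \<sigma>_norm f \<le> C * m powr \<theta> * N f powr (1 - \<theta>)"
  unfolding \<sigma>_norm_def using interpolation by blast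

lemma \<sigma>_norm_le_N:
  assumes "f \<in> A"
  shows "\<sigma>_norm f \<le> C * N f"
proof -
  have "N f powr \<theta> * N f powr (1 - \<theta>) = N f"
    using lpw_norm_nonneg[of p \<omega> f] by (simp only: powr_add[symmetric]) simp
  then show ?thesis using \<sigma>_norm_le[OF assms norm_le_N[OF assms]] by (simp add: mult.assoc)
qed

text \<open>The lower bound \<open>c\<close> of \<omega> u makes the \<sigma>-norm at least
  \<open>c\<close> times the l^1 norm; this is what lets \<open>lreg\<close> act on the
  space.\<close>

lemma mem_lp1:
  assumes "f \<in> A"
  shows "f \<in> lp 1" "lp_norm 1 f \<le> C / c * N f"
proof -
  have s: "(\<lambda>x. norm (f x) * (\<omega> x * u x) / c) summable_on UNIV"
    using summable_on_cmult_left[OF \<sigma>_summable[OF assms], of "inverse c"] by (simp add: divide_inverse)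
  have le: "norm (f x) \<le> norm (f x) * (\<omega> x * u x) / c" for x
    using mult_left_mono[OF c_le[of x], of "norm (f x)"] c_pos by (simp add: field_simps)
  have s1: "(\<lambda>x. norm (f x)) summable_on UNIV"
    by (rule summable_on_comparison_test[OF s]) (use le in auto)
  then show "f \<in> lp 1" by (simp add: lp1_iff)
  have "lp_norm 1 f \<le> (\<Sum>\<^sub>\<infinity>x. norm (f x) * (\<omega> x * u x) / c)"
    unfolding lp1_norm by (rule infsum_mono[OF s1 s le])
  also have "\<dots> = \<sigma>_norm f / c"
    using infsum_cmult_left'[of "\<lambda>x. norm (f x) * (\<omega> x * u x)" "inverse c" UNIV]
    by (simp add: \<sigma>_norm_def divide_inverse)
  also have "\<dots> \<le> C / c * N f" using \<sigma>_norm_le_N[OF assms] c_pos by (simp add: divide_right_mono)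
  finally show "lp_norm 1 f \<le> C / c * N f" .
qed

lemma abs_weighted_lp:
  assumes "f \<in> A"
  shows "(\<lambda>x. norm (f x) * \<omega> x) \<in> lp p" "lp_norm p (\<lambda>x. norm (f x) * \<omega> x) = N f"
  using assms weight by (auto simp: lpw_def lp_def lpw_norm_def lp_norm_def norm_mult abs_mult weight_def)

text \<open>The bound \<open>\<omega>(xy) \<le> \<omega>(x) \<omega>(y) (u(x) + u(y))\<close> splits the convolution into the two terms estimated here.\<close>

lemma conv_estimate:
  assumes f: "f \<in> A" and g: "g \<in> A"
  shows "conv f g \<in> A \<and> N (conv f g) \<le> \<sigma>_norm f * N g + \<sigma>_norm g * N f"
proof -
  define a b where "a = (\<lambda>y. norm (f y) * (\<omega> y * u y))" and "b = (\<lambda>y. norm (g y) * (\<omega> y * u y))"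
  define hl hr where "hl = (\<lambda>y x. norm (g (- y + x)) * \<omega> (- y + x))"
    and "hr = (\<lambda>z x. norm (f (x - z)) * \<omega> (x - z))"
  have \<omega>0: "0 \<le> \<omega> x" for x using weight by (simp add: weight_def)
  have a: "0 \<le> a y" "a summable_on UNIV" "infsum a UNIV = \<sigma>_norm f" for y
    using \<sigma>_summable[OF f] \<omega>0 u_nonneg by (auto simp: a_def \<sigma>_norm_def)
  have b: "0 \<le> b y" "b summable_on UNIV" "infsum b UNIV = \<sigma>_norm g" for y
    using \<sigma>_summable[OF g] \<omega>0 u_nonneg by (auto simp: b_def \<sigma>_norm_def)
  have hl: "hl y \<in> lp p" "lp_norm p (hl y) \<le> N g" for y
    using abs_weighted_lp[OF g]
      lp_reindex[where \<phi> = "\<lambda>x. - y + x" and f = "\<lambda>x. norm (g x) * \<omega> x" and p = p, OF bij_add_left]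
    by (auto simp: hl_def)
  have hr: "hr y \<in> lp p" "lp_norm p (hr y) \<le> N f" for y
    using abs_weighted_lp[OF f]
      lp_reindex[where \<phi> = "\<lambda>x. x - y" and f = "\<lambda>x. norm (f x) * \<omega> x" and p = p, OF bij_diff_right]
    by (auto simp: hr_def)
  \<comment> \<open>\<open>P\<close> mixes left translates of \<bar>g\<bar> \<omega> with weights
    \<bar>f\<bar> \<omega> u, and \<open>R\<close> mixes right translates of \<bar>f\<bar> \<omega>
    with weights \<bar>g\<bar> \<omega> u. Translation on either side preserves the l^p norm, so
    \<open>lp_minkowski\<close> bounds both.\<close>
  define P R where "P = (\<lambda>x. \<Sum>\<^sub>\<infinity>y. a y * hl y x)" and "R = (\<lambda>x. \<Sum>\<^sub>\<infinity>z. b z * hr z x)"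
  note mP = lp_minkowski[of p a hl "N g", OF p a(1,2) hl lpw_norm_nonneg, folded P_def]
  note mR = lp_minkowski[of p b hr "N f", OF p b(1,2) hr lpw_norm_nonneg, folded R_def]
  have PR: "(\<lambda>x. P x + R x) \<in> lp p" "lp_norm p (\<lambda>x. P x + R x) \<le> \<sigma>_norm f * N g + \<sigma>_norm g * N f"
    using mP(2) mR(2) lp_triangle[OF p, of P R] a b by auto
  have "norm (conv f g x * complex_of_real (\<omega> x)) \<le> norm (P x + R x)" for x
  proof -
    \<comment> \<open>The substitution z = - y + x gives \<open>R\<close> the summation variable of
      the convolution, so that it can be compared termwise.\<close>
    have R: "R x = (\<Sum>\<^sub>\<infinity>y. b (- y + x) * hr (- y + x) x)"
        "(\<lambda>y. b (- y + x) * hr (- y + x) x) summable_on UNIV"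
      using infsum_reindex_bij_betw[OF bij_uminus_add[of x], of "\<lambda>z. b z * hr z x"]
        summable_on_reindex_bij_betw[OF bij_uminus_add[of x], of "\<lambda>z. b z * hr z x"] mR(1)
      by (auto simp: R_def)
    have le: "norm (f y * g (- y + x)) * \<omega> x \<le> a y * hl y x + b (- y + x) * hr (- y + x) x" for y
    proof -
      have xy: "x - (- y + x) = y"
        by (simp add: diff_conv_add_uminus minus_add add.assoc[symmetric] del: add_uminus_conv_diff)
      have "norm (f y * g (- y + x)) * \<omega> x
          \<le> norm (f y * g (- y + x)) * (\<omega> y * \<omega> (- y + x) * (u y + u (- y + x)))"
        using submult[of y "- y + x"] by (intro mult_left_mono) (auto simp: add.assoc[symmetric])
      also have "norm (f y * g (- y + x)) * (\<omega> y * \<omega> (- y + x) * (u y + u (- y + x)))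
          = a y * hl y x + b (- y + x) * hr (- y + x) x"
        by (simp add: a_def b_def hl_def hr_def xy norm_mult algebra_simps)
      finally show ?thesis .
    qed
    have s: "(\<lambda>y. a y * hl y x + b (- y + x) * hr (- y + x) x) summable_on UNIV"
      using mP(1) R(2) by (rule summable_on_add)
    have t: "(\<lambda>y. norm (f y * g (- y + x)) * \<omega> x) summable_on UNIV"
      by (rule summable_on_comparison_test[OF s le]) (use \<omega>0 in auto)
    then have t': "(\<lambda>y. norm (f y * g (- y + x))) summable_on UNIV"
      using summable_on_cmult_left[OF t, of "inverse (\<omega> x)"] weight_ge1[of x] by (simp add: field_simps)
    have "norm (conv f g x * complex_of_real (\<omega> x)) \<le> (\<Sum>\<^sub>\<infinity>y. norm (f y * g (- y + x))) * \<omega> x"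
      using norm_infsum_bound[OF t'] \<omega>0[of x] by (auto simp: norm_mult conv_def intro!: mult_right_mono)
    also have "\<dots> \<le> (\<Sum>\<^sub>\<infinity>y. a y * hl y x + b (- y + x) * hr (- y + x) x)"
      unfolding infsum_cmult_left'[symmetric] by (rule infsum_mono[OF t s le])
    also have "\<dots> = P x + R x" unfolding R(1) P_def by (rule infsum_add[OF mP(1) R(2)])
    finally show ?thesis by simp
  qed
  from lp_dominated[OF p_pos PR(1) this] PR(2) show ?thesis
    by (auto simp: lpw_def lpw_norm_def)
qed

lemma conv_mem: "f \<in> A \<Longrightarrow> g \<in> A \<Longrightarrow> conv f g \<in> A"
  using conv_estimate by blast

lemma N_conv_le:
  assumes "f \<in> A" "g \<in> A"
  shows "N (conv f g) \<le> 2 * C * N f * N g"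
proof -
  have "N (conv f g) \<le> \<sigma>_norm f * N g + \<sigma>_norm g * N f" using conv_estimate[OF assms] by blast
  also have "\<dots> \<le> C * N f * N g + C * N g * N f"
    using assms by (intro add_mono mult_right_mono \<sigma>_norm_le_N lpw_norm_nonneg)
  finally show ?thesis by simp
qed

lemma delta_mem: "delta_e \<in> A" and N_delta: "N delta_e = 1"
proof -
  have "(\<lambda>x. delta_e x * complex_of_real (\<omega> x)) = delta_e"
    using weight by (auto simp: delta_e_def weight_def)
  then show "delta_e \<in> A" "N delta_e = 1" using delta_lp[OF p_pos] by (auto simp: lpw_def lpw_norm_def)
qed

lemma star_mem: "f \<in> A \<Longrightarrow> star f \<in> A" and N_star: "N (star f) = N f"
proof -
  have \<omega>: "\<omega> (- x) = \<omega> x" for x using weight by (simp add: weight_def)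
  have "(\<lambda>x. norm (star f x * complex_of_real (\<omega> x))) = (\<lambda>x. norm (f (- x) * complex_of_real (\<omega> (- x))))" for f
    by (simp add: star_def \<omega> norm_mult)
  then have e: "norm (star f x * complex_of_real (\<omega> x)) = norm (f (- x) * complex_of_real (\<omega> (- x)))" for f x
    by meson
  have i: "star f \<in> A \<longleftrightarrow> (\<lambda>x. f (- x) * complex_of_real (\<omega> (- x))) \<in> lp p"
      "N (star f) = lp_norm p (\<lambda>x. f (- x) * complex_of_real (\<omega> (- x)))" for f
    unfolding lpw_def lpw_norm_def lp_def lp_norm_def mem_Collect_eq e by auto
  have r: "(\<lambda>x. f (- x) * complex_of_real (\<omega> (- x))) \<in> lp p \<longleftrightarrow> f \<in> A"
    "lp_norm p (\<lambda>x. f (- x) * complex_of_real (\<omega> (- x))) = N f" for f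
    using lp_reindex[where \<phi> = uminus and f = "\<lambda>x. f x * complex_of_real (\<omega> x)" and p = p, OF bij_uminus_group]
    by (auto simp: lpw_def lpw_norm_def)
  show "f \<in> A \<Longrightarrow> star f \<in> A" "N (star f) = N f" using i[of f] r[of f] by auto
qed

lemma conv_summable_mem: "f \<in> A \<Longrightarrow> g \<in> A \<Longrightarrow> (\<lambda>y. f y * g (- y + x)) summable_on UNIV"
  by (rule conv_summable_bounded[OF mem_lp1(1) norm_le_N])

lemma conv_assoc_mem: "f \<in> A \<Longrightarrow> g \<in> A \<Longrightarrow> h \<in> A \<Longrightarrow> conv (conv f g) h = conv f (conv g h)"
  by (rule conv_assoc[OF mem_lp1(1) mem_lp1(1) norm_le_N])

theorem banach_star_algebra: "conv_banach_star_algebra A N"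
  unfolding conv_banach_star_algebra_def
proof (intro conjI ballI allI)
  show "banach_space_on A N" by (rule lpw_banach_space[OF weight_ge1 p])
  show "\<exists>K>0. \<forall>f\<in>A. \<forall>g\<in>A. N (conv f g) \<le> K * N f * N g"
    using N_conv_le C_pos by (intro exI[of _ "2 * C"]) auto
  fix f g h :: "'a \<Rightarrow> complex" and a x
  assume f: "f \<in> A"
  show "conv delta_e f = f" "conv f delta_e = f" by (simp_all add: conv_delta_left conv_delta_right)
  show "star f \<in> A" "N (star f) = N f" "star (star f) = f"
    using f by (simp_all add: star_mem N_star star_star)
  show "star (\<lambda>x. a * f x) = (\<lambda>x. cnj a * star f x)" by (simp add: star_def)
  assume g: "g \<in> A"
  show "(\<lambda>y. f y * g (- y + x)) summable_on UNIV" using f g by (rule conv_summable_mem)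
  show "conv f g \<in> A" using f g by (rule conv_mem)
  show "conv (\<lambda>x. a * f x) g = (\<lambda>x. a * conv f g x)"
    by (simp add: conv_def mult.assoc infsum_cmult_right')
  show "conv f (\<lambda>x. a * g x) = (\<lambda>x. a * conv f g x)"
    by (simp add: conv_def mult.left_commute[of _ a] infsum_cmult_right')
  show "star (\<lambda>x. f x + g x) = (\<lambda>x. star f x + star g x)" by (simp add: star_def)
  show "star (conv f g) = conv (star g) (star f)" by (rule star_conv)
  assume h: "h \<in> A"
  show "conv (conv f g) h = conv f (conv g h)" using f g h by (rule conv_assoc_mem)
  show "conv (\<lambda>x. f x + g x) h = (\<lambda>x. conv f h x + conv g h x)"
    by (simp add: conv_def ring_distribs infsum_add[OF conv_summable_mem[OF f h] conv_summable_mem[OF g h]])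
  show "conv f (\<lambda>x. g x + h x) = (\<lambda>x. conv f g x + conv f h x)"
    by (simp add: conv_def ring_distribs infsum_add[OF conv_summable_mem[OF f g] conv_summable_mem[OF f h]])
qed (rule delta_mem)

end

section \<open>Norm-controlled inversion\<close>

primrec conv_power :: "('a::group_add \<Rightarrow> complex) \<Rightarrow> nat \<Rightarrow> 'a \<Rightarrow> complex" where
  "conv_power f 0 = delta_e"
| "conv_power f (Suc n) = conv (conv_power f n) f"

lemma conv_power_lp1: "f \<in> lp 1 \<Longrightarrow> conv_power f n \<in> lp 1"
  by (induction n) (simp_all add: delta_lp conv_lp1)

lemma conv_power_add:
  assumes "f \<in> lp 1"
  shows "conv_power f (m + n) = conv (conv_power f m) (conv_power f n)"
proof (induction n)
  case 0 then show ?case by (simp add: conv_delta_right)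
next
  case (Suc n)
  have "\<And>x. norm (f x) \<le> lp_norm 1 f" using norm_le_lp_norm[of 1 f] assms by simp
  then show ?case
    using conv_assoc[OF conv_power_lp1[OF assms] conv_power_lp1[OF assms], of f "lp_norm 1 f" m n] Suc by simp
qed

lemma norm_lreg_conv_power_le:
  assumes f: "f \<in> lp 1" and \<rho>: "norm (lreg f) \<le> \<rho>"
  shows "norm (lreg (conv_power f n)) \<le> \<rho> ^ n"
proof (induction n)
  case 0
  have "norm (id_blinfun :: 'a ell2 \<Rightarrow>\<^sub>L 'a ell2) \<le> 1" by (rule norm_blinfun_bound) auto
  then show ?case by (simp add: lreg_delta)
next
  case (Suc n)
  have "norm (lreg (conv_power f (Suc n))) \<le> norm (lreg (conv_power f n)) * norm (lreg f)"
    using norm_blinfun_compose by (simp add: lreg_conv conv_power_lp1 f)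
  also have "\<dots> \<le> \<rho> ^ n * \<rho>"
    using Suc \<rho> order_trans[OF norm_ge_zero \<rho>] by (intro mult_mono) auto
  finally show ?case by (simp add: mult.commute)
qed

lemma lreg_diff:
  assumes "f \<in> lp 1" "g \<in> lp 1"
  shows "lreg (\<lambda>x. f x - g x) = lreg f - lreg g"
  using lreg_add[OF assms(1) lp_scale(1)[OF zero_less_one assms(2), of "complex_of_real (- 1)"]]
    lreg_scaleR[OF assms(2), of "- 1"] by simp

context lpw_algebra
begin

lemma norm_lreg_le_N: "f \<in> A \<Longrightarrow> norm (lreg f) \<le> C / c * N f"
  using norm_lreg_le[OF mem_lp1(1)] mem_lp1(2) order_trans by blast

lemma conv_power_mem: "f \<in> A \<Longrightarrow> conv_power f n \<in> A"
  by (induction n) (simp_all add: delta_mem conv_mem)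

lemma sum_mem:
  fixes F :: "nat \<Rightarrow> 'a \<Rightarrow> complex"
  assumes "\<And>i. F i \<in> A"
  shows "(\<lambda>x. \<Sum>i\<in>I. F i x) \<in> A \<and> N (\<lambda>x. \<Sum>i\<in>I. F i x) \<le> (\<Sum>i\<in>I. N (F i))"
proof (induction I rule: infinite_finite_induct)
  case (insert i I)
  then show ?case
    using lpw_add[OF p assms[of i], of "\<lambda>x. \<Sum>i\<in>I. F i x"] by auto
qed (simp_all add: lpw_def lpw_norm_def lp_zero[OF p_pos])

lemma N_conv_power_double:
  assumes f: "f \<in> A" and \<rho>: "norm (lreg f) \<le> \<rho>" "0 < \<rho>"
  shows "N (conv_power f (2 * n)) \<le> 2 * C * N (conv_power f n) powr (2 - \<theta>) * \<rho> powr (real n * \<theta>)"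
proof -
  let ?g = "conv_power f n"
  have g: "?g \<in> A" using f by (rule conv_power_mem)
  have N0: "0 \<le> N ?g" by (rule lpw_norm_nonneg)
  have "norm (?g x) \<le> \<rho> ^ n" for x
    using norm_le_norm_lreg[OF mem_lp1(1)[OF g]] norm_lreg_conv_power_le[OF mem_lp1(1)[OF f] \<rho>(1)] order_trans by blast
  from \<sigma>_norm_le[OF g this] have \<sigma>: "\<sigma>_norm ?g \<le> C * \<rho> powr (real n * \<theta>) * N ?g powr (1 - \<theta>)"
    using \<rho> by (simp add: powr_powr flip: powr_realpow)
  have "N (conv_power f (2 * n)) \<le> 2 * (\<sigma>_norm ?g * N ?g)"
    unfolding mult_2[of n] conv_power_add[OF mem_lp1(1)[OF f]] using conv_estimate[OF g g] by linarith
  also have "\<dots> \<le> 2 * (C * \<rho> powr (real n * \<theta>) * N ?g powr (1 - \<theta>) * N ?g)"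
    using \<sigma> N0 by (intro mult_left_mono mult_right_mono) auto
  also have "\<dots> = 2 * C * \<rho> powr (real n * \<theta>) * (N ?g powr (1 - \<theta>) * N ?g powr 1)"
    using N0 by simp
  also have "\<dots> = 2 * C * N ?g powr (2 - \<theta>) * \<rho> powr (real n * \<theta>)"
    by (simp only: powr_add[symmetric]) (simp add: mult_ac)
  finally show ?thesis .
qed

text \<open>A bounded series of norms converges, so the partial sums converge in the algebra to some
  g, and their operators converge because \<open>lreg\<close> is continuous for \<open>N\<close>.
  The recursion S(n + 1) = S(n) b + 1, proved for the operators, passes to the limit.\<close>

lemma neumann_series:
  assumes b: "b \<in> A" and H: "\<And>n. (\<Sum>i<n. N (conv_power b i)) \<le> H"
  obtains g where "g \<in> A" "N g \<le> H" "(lreg g o\<^sub>L lreg b) + id_blinfun = lreg g"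
proof -
  define S where "S = (\<lambda>n x. \<Sum>i<n. conv_power b i x)"
  have S: "S n \<in> A" "N (S n) \<le> H" for n
    using sum_mem[of "conv_power b" "{..<n}"] conv_power_mem[OF b] order_trans[OF _ H]
    by (auto simp: S_def)
  have "summable (\<lambda>i. N (conv_power b i))"
    by (rule bounded_imp_summable[of _ H]) (use H[of "Suc _"] lpw_norm_nonneg in \<open>auto simp: lessThan_Suc_atMost\<close>)
  then have "Cauchy (\<lambda>n. \<Sum>i<n. N (conv_power b i))"
    by (simp add: summable_iff_convergent Cauchy_convergent_iff)
  have cauchy: "\<exists>M. \<forall>m\<ge>M. \<forall>n\<ge>M. N (\<lambda>x. S m x - S n x) < \<epsilon>" if \<epsilon>: "0 < \<epsilon>" for \<epsilon>
  proof -
    obtain M where M: "\<And>m n. M \<le> m \<Longrightarrow> M \<le> n \<Longrightarrow>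
        norm ((\<Sum>i<m. N (conv_power b i)) - (\<Sum>i<n. N (conv_power b i))) < \<epsilon>"
      using CauchyD[OF \<open>Cauchy _\<close> \<epsilon>] by blast
    have le: "N (\<lambda>x. S m x - S n x) \<le> (\<Sum>i<m. N (conv_power b i)) - (\<Sum>i<n. N (conv_power b i))" if "n \<le> m" for m n
    proof -
      have d: "sum F {..<m} - sum F {..<n} = sum F ({..<m} - {..<n})" for F :: "nat \<Rightarrow> 'b::ab_group_add"
        using that by (subst sum_diff) auto
      show ?thesis
        unfolding S_def d using sum_mem[of "conv_power b"] conv_power_mem[OF b] by blast
    qed
    have sym: "N (\<lambda>x. S m x - S n x) = N (\<lambda>x. S n x - S m x)" for m n
      using lpw_scale(2)[OF p lpw_diff[OF p S(1) S(1)], of "- 1" n m] by simp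
    have "N (\<lambda>x. S m x - S n x) < \<epsilon>" if "M \<le> m" "M \<le> n" for m n
    proof (cases "n \<le> m")
      case True then show ?thesis using le[of n m] M[OF that] by auto
    next
      case False then show ?thesis using le[of m n] M[OF that(2,1)] sym[of m n] by auto
    qed
    then show ?thesis by blast
  qed
  obtain g where g: "g \<in> A" and lim: "(\<lambda>n. N (\<lambda>x. S n x - g x)) \<longlonglongrightarrow> 0"
    using lpw_complete[where \<omega> = \<omega>, OF weight_ge1 p S(1) cauchy] by blast
  have "N g \<le> H"
  proof (rule LIMSEQ_le_const)
    show "(\<lambda>n. H + N (\<lambda>x. S n x - g x)) \<longlonglongrightarrow> H" using tendsto_add[OF tendsto_const lim] by simp
    have "N g \<le> H + N (\<lambda>x. S n x - g x)" for n
    proof -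
      have d: "(\<lambda>x. S n x - g x) \<in> A" by (rule lpw_diff[OF p S(1) g])
      have "N (\<lambda>x. S n x + - 1 * (S n x - g x)) \<le> N (S n) + N (\<lambda>x. - 1 * (S n x - g x))"
        by (rule lpw_add(2)[OF p S(1) lpw_scale(1)[OF p d]])
      then show ?thesis using S(2)[of n] lpw_scale(2)[OF p d, of "- 1"] by simp
    qed
    then show "\<exists>n0. \<forall>n\<ge>n0. N g \<le> H + N (\<lambda>x. S n x - g x)" by blast
  qed
  have lreg_lim: "(\<lambda>n. lreg (S n)) \<longlonglongrightarrow> lreg g"
  proof (rule LIM_zero_cancel, rule Lim_null_comparison)
    show "(\<lambda>n. C / c * N (\<lambda>x. S n x - g x)) \<longlonglongrightarrow> 0"
      using tendsto_mult[OF tendsto_const lim, of "C / c"] by simp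
    have "norm (lreg (S n) - lreg g) \<le> C / c * N (\<lambda>x. S n x - g x)" for n
      using norm_lreg_le_N[OF lpw_diff[OF p S(1)[of n] g]]
      unfolding lreg_diff[OF mem_lp1(1)[OF S(1)[of n]] mem_lp1(1)[OF g]] .
    then show "\<forall>\<^sub>F n in sequentially. norm (lreg (S n) - lreg g) \<le> C / c * N (\<lambda>x. S n x - g x)"
      by simp
  qed
  have step: "lreg (S (Suc n)) = lreg (S n) + lreg (conv_power b n)" for n
    using lreg_add[OF mem_lp1(1)[OF S(1)[of n]] mem_lp1(1)[OF conv_power_mem[OF b, of n]]]
    by (simp add: S_def)
  have S0: "lreg (S 0) = 0"
    using lreg_scaleR[OF mem_lp1(1)[OF delta_mem], of 0] by (simp add: S_def)
  have rec: "lreg (S (Suc n)) = (lreg (S n) o\<^sub>L lreg b) + id_blinfun" for n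
  proof (induction n)
    case 0
    show ?case unfolding step S0 by (rule blinfun_eqI) (simp add: lreg_delta)
  next
    case (Suc n)
    have "lreg (S (Suc (Suc n))) = (lreg (S n) o\<^sub>L lreg b) + id_blinfun + (lreg (conv_power b n) o\<^sub>L lreg b)"
      using Suc step[of "Suc n"] lreg_conv[OF mem_lp1(1)[OF conv_power_mem[OF b, of n]] mem_lp1(1)[OF b]] by simp
    also have "\<dots> = (lreg (S (Suc n)) o\<^sub>L lreg b) + id_blinfun"
      unfolding step[of n] by (rule blinfun_eqI) (simp add: blinfun.add_left)
    finally show ?case .
  qed
  have "(\<lambda>n. (lreg (S n) o\<^sub>L lreg b) + id_blinfun) \<longlonglongrightarrow> (lreg g o\<^sub>L lreg b) + id_blinfun"
    by (intro tendsto_add bounded_bilinear.tendsto[OF bounded_bilinear_blinfun_compose] lreg_lim tendsto_const)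
  then have "(\<lambda>n. lreg (S (Suc n))) \<longlonglongrightarrow> (lreg g o\<^sub>L lreg b) + id_blinfun" by (simp only: rec)
  then have "(lreg g o\<^sub>L lreg b) + id_blinfun = lreg g"
    using LIMSEQ_unique LIMSEQ_Suc[OF lreg_lim] by blast
  with g \<open>N g \<le> H\<close> show ?thesis using that by blast
qed

text \<open>
  With \<open>M = (C/c \<parallel>f\<parallel>)\<^sup>2\<close>, the element \<open>b = \<delta>\<^sub>e - f\<^sup>* * f / M\<close> satisfies \<open>\<parallel>\<lambda>(b)\<parallel> \<le> \<rho> < 1\<close> with \<open>\<rho>\<close>
  depending on \<open>\<parallel>f\<parallel>\<close> and \<open>\<parallel>T\<parallel>\<close> only. If \<open>g = \<Sum> b\<^sup>n\<close> then \<open>g * f\<^sup>* * f = M \<delta>\<^sub>e\<close>, so that \<open>T = \<lambda>(g * f\<^sup>*) / M\<close>.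
\<close>

lemma controlled_inverse:
  fixes \<alpha> \<tau> :: real
  obtains h where "0 \<le> h"
    "\<And>f T. \<lbrakk>f \<in> A; N f = \<alpha>; norm T = \<tau>; lreg f o\<^sub>L T = id_blinfun; T o\<^sub>L lreg f = id_blinfun\<rbrakk>
      \<Longrightarrow> \<exists>g\<in>A. T = lreg g \<and> N g \<le> h"
proof -
  \<comment> \<open>An upper bound for the squared operator norm of \<open>star f\<close> that
    depends on \<alpha> only, as \<open>N (star f) = N f\<close>.\<close>
  define M where "M = (C / c * \<alpha>)\<^sup>2"
  \<comment> \<open>The bound \<open>h\<close> must be chosen from \<alpha> and \<tau> before any f
    is given. Pairs violating these inequalities belong to no invertible f, and for them 0 serves;
    for the others \<rho> and \<open>M\<close> are admissible constants.\<close>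
  have necessary: "0 < \<alpha> \<and> 1 \<le> M * \<tau>\<^sup>2"
    if f: "f \<in> A" "N f = \<alpha>" "norm T = \<tau>" "T o\<^sub>L lreg f = id_blinfun" for f T
  proof -
    define d :: "'a ell2" where "d = Abs_ell2 delta_e"
    have d: "norm d = 1" by (simp add: d_def norm_ell2.rep_eq Abs_ell2_inverse delta_lp)
    have "norm d = norm (T (lreg f d))"
      using that(4) by (metis blinfun_apply_blinfun_compose blinfun_apply_id_blinfun id_apply)
    also have "\<dots> \<le> \<tau> * (norm (lreg f) * norm d)"
      using norm_blinfun[of T "lreg f d"] mult_left_mono[OF norm_blinfun[of "lreg f" d], of \<tau>] that(3)
      by (metis norm_ge_zero order_trans)
    also have "\<dots> \<le> \<tau> * (C / c * \<alpha>)"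
      using norm_lreg_le_N[OF f(1)] f(2,3) d
      by (intro mult_left_mono) auto
    finally have 1: "1 \<le> \<tau> * (C / c * \<alpha>)" using d by simp
    then have "1\<^sup>2 \<le> (\<tau> * (C / c * \<alpha>))\<^sup>2" by (intro power_mono) auto
    moreover have "\<alpha> \<noteq> 0" using 1 by auto
    moreover have "M * \<tau>\<^sup>2 = (\<tau> * (C / c * \<alpha>))\<^sup>2" by (simp add: M_def power2_eq_square)
    ultimately show ?thesis using lpw_norm_nonneg[of p \<omega> f] f(2) by simp
  qed
  show ?thesis
  proof (cases "0 < \<alpha> \<and> 1 \<le> M * \<tau>\<^sup>2")
    case False
    then show ?thesis using necessary that[of 0] by blast
  next
    case True
    then have \<alpha>: "0 < \<alpha>" and M\<tau>: "1 \<le> M * \<tau>\<^sup>2" by auto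
    have M: "0 < M" using \<alpha> C_pos c_pos by (simp add: M_def)
    define \<rho> where "\<rho> = 1 - 1 / (2 * (M * \<tau>\<^sup>2))"
    have "1 / (2 * (M * \<tau>\<^sup>2)) \<le> 1 / 2" "0 < 1 / (2 * (M * \<tau>\<^sup>2))" using M\<tau> by (auto intro!: divide_left_mono simp: divide_simps)
    then have \<rho>: "0 < \<rho>" "\<rho> < 1" by (auto simp: \<rho>_def)
    \<comment> \<open>By the triangle inequality this bounds \<open>N b\<close>, the 1 being
      \<open>N delta_e\<close>; it therefore bounds the zeroth and the first power at once.\<close>
    define B where "B = 1 + 2 * C * \<alpha>\<^sup>2 / M"
    have B: "1 \<le> B" using C_pos M by (simp add: B_def)
    obtain H where H: "0 \<le> H" "\<And>\<nu> n. \<lbrakk>\<And>n. 0 \<le> \<nu> n; \<nu> 0 \<le> B; \<nu> 1 \<le> B;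
        \<And>m n. \<nu> (m + n) \<le> 2 * C * \<nu> m * \<nu> n;
        \<And>n. \<nu> (2 * n) \<le> 2 * C * \<nu> n powr (2 - \<theta>) * \<rho> powr (real n * \<theta>)\<rbrakk> \<Longrightarrow> (\<Sum>i<n. \<nu> i) \<le> H"
    \<comment> \<open>The constant \<open>2 * C\<close> occurs twice: it governs both the product
      estimate for \<open>N\<close> and the doubling estimate.\<close>
    proof (rule partial_sums_uniformly_bounded[of "2 * C" "2 * C" B \<theta> \<rho>])
      show "0 < 2 * C" "0 < 2 * C" "0 \<le> B" using C_pos B by auto
    qed (use \<theta> \<rho> in blast)+
    show ?thesis
    proof (rule that[of "1 / M * (2 * C * H * \<alpha>)"])
      show "0 \<le> 1 / M * (2 * C * H * \<alpha>)" using M C_pos H(1) \<alpha> by simp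
      fix f T
      assume f: "f \<in> A" "N f = \<alpha>" and T: "norm T = \<tau>" "lreg f o\<^sub>L T = id_blinfun" "T o\<^sub>L lreg f = id_blinfun"
      have sf: "star f \<in> A" "N (star f) = \<alpha>" using f star_mem N_star by auto
      have f1: "f \<in> lp 1" and sf1: "star f \<in> lp 1" using f sf mem_lp1 by auto
      define a where "a = conv (star f) f"
      have a: "a \<in> A" unfolding a_def by (rule conv_mem[OF sf(1) f(1)])
      have Na: "N a \<le> 2 * C * \<alpha>\<^sup>2"
        using N_conv_le[OF sf(1) f(1)] f(2) sf(2) by (simp add: a_def power2_eq_square mult.assoc)
      have La: "lreg a = lreg (star f) o\<^sub>L lreg f" unfolding a_def by (rule lreg_conv[OF sf1 f1])
      define b where "b = (\<lambda>x. delta_e x - complex_of_real (1 / M) * a x)"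
      have aM: "(\<lambda>x. complex_of_real (1 / M) * a x) \<in> A" by (rule lpw_scale(1)[OF p a])
      have b: "b \<in> A" unfolding b_def by (rule lpw_diff[OF p delta_mem aM])
      have Lb: "lreg b = id_blinfun - (1 / M) *\<^sub>R lreg a"
        unfolding b_def lreg_diff[OF mem_lp1(1)[OF delta_mem] mem_lp1(1)[OF aM]]
          lreg_scaleR[OF mem_lp1(1)[OF a]] lreg_delta ..
      have "norm (lreg (star f)) \<le> C / c * \<alpha>"
        using norm_lreg_le_N[OF sf(1)] sf(2) by simp
      then have "(norm (lreg (star f)))\<^sup>2 \<le> M" unfolding M_def by (intro power_mono) auto
      from norm_id_minus_adjoint_comp_le[OF lreg_adjoint[OF f1 sf1] M this T(3)] M\<tau> T(1)
      have b\<rho>: "norm (lreg b) \<le> \<rho>" by (simp add: Lb La \<rho>_def)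
      have Nb: "N b \<le> B"
      proof -
        have "N (\<lambda>x. delta_e x + complex_of_real (- 1 / M) * a x)
            \<le> N delta_e + N (\<lambda>x. complex_of_real (- 1 / M) * a x)"
          by (rule lpw_add(2)[OF p delta_mem lpw_scale(1)[OF p a]])
        also have "N (\<lambda>x. complex_of_real (- 1 / M) * a x) = N a / M"
          using M unfolding lpw_scale(2)[OF p a] by (simp add: norm_divide)
        finally show ?thesis
          using Na M by (simp add: b_def B_def N_delta) (meson add_left_mono divide_right_mono less_imp_le order_trans)
      qed
      have sums: "(\<Sum>i<n. N (conv_power b i)) \<le> H" for n
      proof (rule H(2))
        show "N (conv_power b 0) \<le> B" "N (conv_power b 1) \<le> B"
          using B Nb by (simp_all add: N_delta conv_delta_left)
        show "N (conv_power b (m + n)) \<le> 2 * C * N (conv_power b m) * N (conv_power b n)" for m n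
          unfolding conv_power_add[OF mem_lp1(1)[OF b]] by (intro N_conv_le conv_power_mem b)
      qed (use lpw_norm_nonneg N_conv_power_double[OF b b\<rho> \<rho>(1)] in auto)
      obtain g where g: "g \<in> A" "N g \<le> H" "(lreg g o\<^sub>L lreg b) + id_blinfun = lreg g"
        using neumann_series[OF b sums] by blast
      have "lreg g (lreg b x) + x = lreg g x" for x
        using g(3) by (metis blinfun.add_left blinfun_apply_blinfun_compose blinfun_apply_id_blinfun id_apply)
      then have ga: "(1 / M) *\<^sub>R lreg g (lreg (star f) (lreg f x)) = x" for x
        by (simp add: Lb La blinfun.diff_left blinfun.diff_right blinfun.scaleR_left blinfun.scaleR_right algebra_simps)
      define k where "k = (\<lambda>x. complex_of_real (1 / M) * conv g (star f) x)"
      have gs: "conv g (star f) \<in> A" by (rule conv_mem[OF g(1) sf(1)])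
      have "T = lreg k"
      proof (rule blinfun_eqI)
        fix x
        \<comment> \<open>The Neumann series gives a left inverse of \<open>lreg f\<close>;
          evaluating it here, with \<open>T\<close> as right inverse, identifies the two.\<close>
        have "x = lreg f (T x)"
          using T(2) by (metis blinfun_apply_blinfun_compose blinfun_apply_id_blinfun id_apply)
        then have "T x = (1 / M) *\<^sub>R lreg g (lreg (star f) x)" using ga[of "T x"] by metis
        also have "\<dots> = lreg k x"
          unfolding k_def lreg_scaleR[OF mem_lp1(1)[OF gs]] lreg_conv[OF mem_lp1(1)[OF g(1)] sf1]
          by (simp add: blinfun.scaleR_left)
        finally show "T x = lreg k x" .
      qed
      moreover have "k \<in> A" unfolding k_def by (rule lpw_scale(1)[OF p gs])
      moreover have "N k \<le> 1 / M * (2 * C * H * \<alpha>)"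
      proof -
        have "N k = 1 / M * N (conv g (star f))"
          unfolding k_def lpw_scale(2)[OF p gs] using M by (simp add: norm_divide)
        also have "\<dots> \<le> 1 / M * (2 * C * N g * \<alpha>)"
          using N_conv_le[OF g(1) sf(1)] sf(2) M by (intro mult_left_mono) auto
        also have "\<dots> \<le> 1 / M * (2 * C * H * \<alpha>)"
          using g(2) M C_pos \<alpha> by (intro mult_left_mono mult_right_mono) auto
        finally show ?thesis .
      qed
      ultimately show "\<exists>g\<in>A. T = lreg g \<and> N g \<le> 1 / M * (2 * C * H * \<alpha>)" by blast
    qed
  qed
qed

lemma inverse_closed: "inverse_closed_in_cstar_r A"
  unfolding inverse_closed_in_cstar_r_def
proof (intro conjI subsetI ballI allI impI)
  fix f T assume "f \<in> A" "cstar_r_inverse (lreg f) T"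
  then show "\<exists>g\<in>A. T = lreg g"
    using controlled_inverse[of "N f" "norm T"] unfolding cstar_r_inverse_def by metis
qed (rule mem_lp1)

text \<open>For each pair of values \<alpha>, \<tau> a bound exists, and choice assembles these
  bounds into a function. Injectivity of \<open>lreg\<close> on l^1(G) identifies the bounded
  preimage from \<open>controlled_inverse\<close> with the given g.\<close>

lemma norm_controlled: "norm_controlled_inversion_in_cstar_r A N"
  unfolding norm_controlled_inversion_in_cstar_r_def
proof (intro conjI inverse_closed)
  have "\<forall>\<alpha> \<tau>. \<exists>h\<ge>0. \<forall>f\<in>A. \<forall>g\<in>A. N f = \<alpha> \<and> norm (lreg g) = \<tau> \<and> cstar_r_inverse (lreg f) (lreg g) \<longrightarrow> N g \<le> h"
  proof (intro allI)
    fix \<alpha> \<tau>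
    obtain h where h: "0 \<le> h"
      "\<And>f T. \<lbrakk>f \<in> A; N f = \<alpha>; norm T = \<tau>; lreg f o\<^sub>L T = id_blinfun; T o\<^sub>L lreg f = id_blinfun\<rbrakk>
        \<Longrightarrow> \<exists>g\<in>A. T = lreg g \<and> N g \<le> h"
      using controlled_inverse by blast
    have "N g \<le> h" if fg: "f \<in> A" "g \<in> A" "N f = \<alpha>" "norm (lreg g) = \<tau>" "cstar_r_inverse (lreg f) (lreg g)" for f g
    proof -
      obtain g' where "g' \<in> A" "lreg g = lreg g'" "N g' \<le> h"
        using h(2)[OF fg(1,3,4)] fg(5) unfolding cstar_r_inverse_def by blast
      then show ?thesis using lreg_inject[OF mem_lp1(1)[OF fg(2)] mem_lp1(1)] by metis
    qed
    then show "\<exists>h\<ge>0. \<forall>f\<in>A. \<forall>g\<in>A. N f = \<alpha> \<and> norm (lreg g) = \<tau> \<and> cstar_r_inverse (lreg f) (lreg g) \<longrightarrow> N g \<le> h"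
      using h(1) by blast
  qed
  then obtain h where "\<And>\<alpha> \<tau>. 0 \<le> h \<alpha> \<tau>" "\<And>\<alpha> \<tau> f g. f \<in> A \<Longrightarrow> g \<in> A \<Longrightarrow>
      N f = \<alpha> \<and> norm (lreg g) = \<tau> \<and> cstar_r_inverse (lreg f) (lreg g) \<Longrightarrow> N g \<le> h \<alpha> \<tau>"
    by metis
  then show "\<exists>h. (\<forall>a\<ge>0. \<forall>b\<ge>0. 0 \<le> h a b) \<and>
        (\<forall>f\<in>A. \<forall>g\<in>A. cstar_r_inverse (lreg f) (lreg g) \<longrightarrow> N g \<le> h (N f) (norm (lreg g)))"
    by blast
qed

end

section \<open>Reduction of both sets of hypotheses to the abstract setting\<close>

text \<open>The condition \<open>1 - 1 / p < 1 / s\<close> expresses s < q in real numbers; for p =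
  1, where q is infinite, it holds for every positive s.\<close>

lemma lpw_conclusion:
  fixes \<omega> u :: "'a::group_add \<Rightarrow> real"
  assumes \<omega>: "weight \<omega>" and p: "1 \<le> p" and u: "\<And>x. 0 \<le> u x"
    and \<sigma>: "bounded_away_from_zero (\<lambda>x. \<omega> x * u x)"
    and sub: "\<And>x y. \<omega> (x + y) / (\<omega> x * \<omega> y) \<le> u x + u y"
    and s: "0 < s" "1 - 1 / p < 1 / s" and r: "0 < r"
    and sm: "(\<lambda>x. u x powr s * \<omega> x powr r) summable_on UNIV"
  shows "conv_banach_star_algebra (lpw p \<omega>) (lpw_norm p \<omega>) \<and>
    inverse_closed_in_cstar_r (lpw p \<omega>) \<and>
    norm_controlled_inversion_in_cstar_r (lpw p \<omega>) (lpw_norm p \<omega>)"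
proof -
  obtain c where c: "0 < c" "\<And>x. c \<le> \<omega> x * u x"
    using \<sigma> by (auto simp: bounded_away_from_zero_def)
  obtain C \<theta> where C: "0 < C" "0 < \<theta>" "\<theta> < 1"
    "\<And>f m. \<lbrakk>f \<in> lpw p \<omega>; \<And>x. norm (f x) \<le> m\<rbrakk> \<Longrightarrow> (\<lambda>x. norm (f x) * (\<omega> x * u x)) summable_on UNIV \<and>
      (\<Sum>\<^sub>\<infinity>x. norm (f x) * (\<omega> x * u x)) \<le> C * m powr \<theta> * lpw_norm p \<omega> f powr (1 - \<theta>)"
    by (rule weighted_l1_interpolation[OF weight_ge_1[OF \<omega>] u p s r sm]) blast
  interpret lpw_algebra \<omega> u p c C \<theta>
  proof
    fix x y
    have "0 < \<omega> x * \<omega> y" using weight_ge_1[OF \<omega>, of x] weight_ge_1[OF \<omega>, of y] by simp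
    then show "\<omega> (x + y) \<le> \<omega> x * \<omega> y * (u x + u y)"
      using sub[of x y] by (simp add: pos_divide_le_eq mult.commute)
  qed (use \<omega> p u c C in blast)+
  show ?thesis using banach_star_algebra inverse_closed norm_controlled by blast
qed

text \<open>The given s may be zero or negative, whereas the interpolation divides by it. As q > 1,
  the maximum of s and 1/2 is positive and still below a finite q.\<close>

lemma conjugate_exponent_below:
  fixes p s :: real and q :: ereal
  assumes p: "1 \<le> p" and q: "1 < q" "1 / ereal p + 1 / q = 1" and s: "ereal s < q"
  obtains t where "0 < t" "s \<le> t" "1 - 1 / p < 1 / t"
proof (cases q)
  case (real q')
  have q': "1 < q'" "1 / p + 1 / q' = 1" "s < q'"
    using q s p by (simp_all add: real one_ereal_def)
  show ?thesis
  proof (rule that)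
    show "0 < max s (1 / 2)" by simp
    show "1 - 1 / p < 1 / max s (1 / 2)"
    proof -
      have "1 / q' < 1 / max s (1 / 2)" using q' by (intro divide_strict_left_mono) auto
      then show ?thesis using q'(2) by linarith
    qed
  qed (use q' in \<open>auto simp: real\<close>)
next
  case PInf
  then have "p = 1" using q p by (simp add: one_ereal_def)
  then show ?thesis using that[of "max s 1"] by simp
qed (use q in simp)

theorem theorem4p1:
  fixes \<omega> :: "'a::group_add \<Rightarrow> real" and p :: real and q :: ereal
  assumes "weight \<omega>"
    and "1 \<le> p"
    and "1 < q" and "1 / ereal p + 1 / q = 1"
  shows
    "(\<forall>(u :: 'a \<Rightarrow> real) (s :: real) (r :: real).
        (\<forall>x. 0 \<le> u x) \<and> bounded (range u) \<and> ereal s < q \<and> 0 < r \<and>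
        bounded_away_from_zero (\<lambda>x. \<omega> x * u x) \<and>
        (\<forall>x y. \<omega> (x + y) / (\<omega> x * \<omega> y) \<le> u x + u y) \<and>
        (\<lambda>x. u x powr s * \<omega> x powr r) summable_on UNIV
      \<longrightarrow> conv_banach_star_algebra (lpw p \<omega>) (lpw_norm p \<omega>) \<and>
          inverse_closed_in_cstar_r (lpw p \<omega>) \<and>
          norm_controlled_inversion_in_cstar_r (lpw p \<omega>) (lpw_norm p \<omega>))
   \<and> (\<forall>s :: real.
        weakly_subadditive \<omega> \<and> 0 < s \<and> ereal s < q \<and> (\<lambda>x. 1 / \<omega> x) \<in> lp s
      \<longrightarrow> conv_banach_star_algebra (lpw p \<omega>) (lpw_norm p \<omega>) \<and>
          inverse_closed_in_cstar_r (lpw p \<omega>) \<and>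
          norm_controlled_inversion_in_cstar_r (lpw p \<omega>) (lpw_norm p \<omega>))"
proof (intro conjI allI impI; elim conjE)
  fix u :: "'a \<Rightarrow> real" and s r :: real
  assume u: "\<forall>x. 0 \<le> u x" and bu: "bounded (range u)" and s: "ereal s < q" and r: "0 < r"
    and \<sigma>: "bounded_away_from_zero (\<lambda>x. \<omega> x * u x)"
    and sub: "\<forall>x y. \<omega> (x + y) / (\<omega> x * \<omega> y) \<le> u x + u y"
    and sm: "(\<lambda>x. u x powr s * \<omega> x powr r) summable_on UNIV"
  obtain t where t: "0 < t" "s \<le> t" "1 - 1 / p < 1 / t"
    using conjugate_exponent_below[OF assms(2,3,4) s] by blast
  obtain U where U: "\<And>x. u x \<le> U"
    using bu by (auto simp: bounded_iff intro: order_trans[OF abs_ge_self])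
  \<comment> \<open>Boundedness of u enters here: raising the exponent from s to t costs the factor
    \<open>U powr (t - s)\<close>.\<close>
  have "(\<lambda>x. u x powr t * \<omega> x powr r) summable_on UNIV"
  proof (rule summable_on_comparison_test)
    show "(\<lambda>x. U powr (t - s) * (u x powr s * \<omega> x powr r)) summable_on UNIV"
      using sm by (rule summable_on_cmult_right)
    show "u x powr t * \<omega> x powr r \<le> U powr (t - s) * (u x powr s * \<omega> x powr r)" for x
    proof -
      have "u x powr t = u x powr (t - s) * u x powr s" by (simp only: powr_add[symmetric]) simp
      also have "\<dots> \<le> U powr (t - s) * u x powr s"
        using t(2) u U by (intro mult_right_mono powr_mono2) auto
      finally show ?thesis by (simp only: mult.assoc[symmetric] mult_right_mono powr_ge_zero)
    qed
  qed auto
  from lpw_conclusion[OF assms(1,2) u[rule_format] \<sigma> sub[rule_format] t(1,3) r this]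
  show "conv_banach_star_algebra (lpw p \<omega>) (lpw_norm p \<omega>)" "inverse_closed_in_cstar_r (lpw p \<omega>)"
    "norm_controlled_inversion_in_cstar_r (lpw p \<omega>) (lpw_norm p \<omega>)" by auto
next
  fix s :: real
  assume ws: "weakly_subadditive \<omega>" and s: "0 < s" "ereal s < q" and sm: "(\<lambda>x. 1 / \<omega> x) \<in> lp s"
  obtain D where D: "0 < D" "\<And>x y. \<omega> (x + y) \<le> D * (\<omega> x + \<omega> y)"
    using ws by (auto simp: weakly_subadditive_def)
  \<comment> \<open>The inequality is strict because \<open>t - s\<close> will play the role of r,
    which has to be positive.\<close>
  obtain t where t: "s < t" "1 - 1 / p < 1 / t"
  proof -
    obtain s' where "ereal s < ereal s'" "ereal s' < q" using ereal_dense2[OF s(2)] by blast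
    then show ?thesis
      using conjugate_exponent_below[OF assms(2,3,4), of s'] that by (metis less_ereal.simps(1) less_le_trans)
  qed
  have \<omega>: "1 \<le> \<omega> x" for x by (rule weight_ge_1[OF assms(1)])
  \<comment> \<open>The choice is u = D/\<omega>: then \<omega> u is the constant \<open>D\<close>,
    weak subadditivity divided by \<omega>(x) \<omega>(y) is the quotient condition, and u^t
    \<omega>^(t - s) reduces to a multiple of \<omega>^(-s).\<close>
  have "(\<lambda>x. (D / \<omega> x) powr t * \<omega> x powr (t - s)) = (\<lambda>x. D powr t * norm (1 / \<omega> x) powr s)"
  proof
    fix x
    show "(D / \<omega> x) powr t * \<omega> x powr (t - s) = D powr t * norm (1 / \<omega> x) powr s"
      using \<omega>[of x] D(1) by (simp add: powr_divide powr_diff)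
  qed
  then have "(\<lambda>x. (D / \<omega> x) powr t * \<omega> x powr (t - s)) summable_on UNIV"
    using sm by (auto simp: lp_def intro!: summable_on_cmult_right)
  moreover have "bounded_away_from_zero (\<lambda>x. \<omega> x * (D / \<omega> x))"
    unfolding bounded_away_from_zero_def using D(1) order_less_le_trans[OF zero_less_one \<omega>]
    by (intro exI[of _ D]) (simp add: less_imp_neq[symmetric])
  moreover have "\<omega> (x + y) / (\<omega> x * \<omega> y) \<le> D / \<omega> x + D / \<omega> y" for x y
    using D(2)[of x y] \<omega>[of x] \<omega>[of y] by (simp add: field_simps)
  moreover have "0 \<le> D / \<omega> x" for x using D(1) \<omega>[of x] by simp
  ultimately show "conv_banach_star_algebra (lpw p \<omega>) (lpw_norm p \<omega>)" "inverse_closed_in_cstar_r (lpw p \<omega>)"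
    "norm_controlled_inversion_in_cstar_r (lpw p \<omega>) (lpw_norm p \<omega>)"
    using lpw_conclusion[OF assms(1,2), of "\<lambda>x. D / \<omega> x" t "t - s"] t s(1) by auto
qed

end
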